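(* Let $\rho\in(0,2)$ and $\sigma>0$. Suppose that the KKT solution set $\bar\Omega$ is nonempty and that both $\Sigma_f+\mathcal S+\sigma\mathcal A\mathcal A^*$ and $\Sigma_g+\mathcal T+\sigma\mathcal B\mathcal B^*$ are positive definite. Let $\{u^k\}=\{(y^k,z^k,x^k)\}$ be a sequence generated by sPGADMM that converges to $\bar u\in\bar\Omega$. Assume that the mapping $R(\cdot)$ is piecewise polyhedral. Then there exists a constant $\hat\kappa>0$ such that for all $k\ge0$, $$\mathrm{dist}(u^k,\bar\Omega)\le\hat\kappa\,\|R(u^k)\|$$ and $$\mathrm{dist}_{\bar{\mathcal M}}^2(u^{k+1},\bar\Omega)+\|z^{k+1}-z^k\|_{\mathcal T}^2\le\hat\vartheta\Big[\mathrm{dist}_{\bar{\mathcal M}}^2(u^{k},\bar\Omega)+\|z^{k}-z^{k-1}\|_{\mathcal T}^2\Big],$$ where $\bar{\mathcal M}:=\rho(2-\rho)^{-1}\mathcal M$ and $$\hat\vartheta=\Big[1+\hat k_5\,\rho\,\big(\rho+(2-\rho)\hat k_5\big)^{-1}\Big]^{-1},\qquad \hat k_5=\min\{1,m_\rho,\tfrac12n_\rho\}\,k_4^{-1}\rho(2-\rho)^{-1}\hat\kappa^{-2}\lambda_{\max}(\bar{\mathcal M})^{-1}.$$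
   Context: Setting. $\mathcal X$, $\mathcal Y=\mathcal Y_1\times\cdots\times\mathcal Y_m$, $\mathcal Z=\mathcal Z_1\times\cdots\times\mathcal Z_n$ are finite-dimensional real Euclidean spaces with inner product $\langle\cdot,\cdot\rangle$ and induced norm $\|\cdot\|$; $\mathcal U:=\mathcal Y\times\mathcal Z\times\mathcal X$ and $u=(y,z,x)\in\mathcal U$. $\mathcal A:\mathcal X\to\mathcal Y$, $\mathcal B:\mathcal X\to\mathcal Z$ are linear with adjoints $\mathcal A^*,\mathcal B^*$, and $c\in\mathcal X$. The problem is $\min f(y)+g(z)$ subject to $\mathcal A^*y+\mathcal B^*z=c$, where $f:\mathcal Y\to(-\infty,+\infty]$, $g:\mathcal Z\to(-\infty,+\infty]$ are closed proper convex functions of the form $f(y)=f_1(y_1)+f_2(y)$, $g(z)=g_1(z_1)+g_2(z)$ with $f_1:\mathcal Y_1\to(-\infty,+\infty]$, $g_1:\mathcal Z_1\to(-\infty,+\infty]$ closed proper convex (not necessarily smooth) and $f_2:\mathcal Y\to\mathbb R$, $g_2:\mathcal Z\to\mathbb R$ convex quadratic. $\Sigma_f$ and $\Sigma_g$ are self-adjoint positive semidefinite operators on $\mathcal Y$ and $\mathcal Z$ such that $\langle\xi'-\xi,y'-y\rangle\ge\|y'-y\|_{\Sigma_f}^2$ for all $y,y'\in\mathrm{dom}(f)$, $\xi\in\partial f(y)$, $\xi'\in\partial f(y')$, and $\langle\zeta'-\zeta,z'-z\rangle\ge\|z'-z\|_{\Sigma_g}^2$ for all $z,z'\in\mathrm{dom}(g)$,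 $\zeta\in\partial g(z)$, $\zeta'\in\partial g(z')$. For a self-adjoint positive semidefinite $\mathcal G$, $\|v\|_{\mathcal G}:=\sqrt{\langle v,\mathcal Gv\rangle}$ and $\mathrm{dist}_{\mathcal G}(u,C):=\inf_{v\in C}\|u-v\|_{\mathcal G}$; $\mathrm{dist}$ is the distance in $\|\cdot\|$. $\lambda_{\max}$ is the largest eigenvalue; $\|\mathcal S\|,\|\mathcal T\|$ are operator norms. $\bar\Omega$ is the set of $(\bar y,\bar z,\bar x)\in\mathcal U$ with $\mathcal A\bar x\in\partial f(\bar y)$, $\mathcal B\bar x\in\partial g(\bar z)$, $\mathcal A^*\bar y+\mathcal B^*\bar z-c=0$ (KKT points). The KKT mapping is $R:\mathcal U\to\mathcal U$, $R(u):=\big(y-\mathrm{Prox}_f(y+\mathcal Ax),\ z-\mathrm{Prox}_g(z+\mathcal Bx),\ \mathcal A^*y+\mathcal B^*z-c\big)$, where $\mathrm{Prox}_f(v)=\arg\min_w\{f(w)+\frac12\|w-v\|^2\}$ and similarly for $g$. A mapping is piecewise polyhedral if its graph is a union of finitely many polyhedral convex sets. Algorithm sPGADMM. Let $\sigma>0$, $\rho\in(0,2)$, and let $\mathcal S:\mathcal Y\to\mathcal Y$, $\mathcal T:\mathcal Z\to\mathcal Z$ be self-adjoint positive semidefinite linear operators. From $(y^0,z^0,x^0)\in\mathrm{dom}(f)\times\mathrm{dom}(g)\times\mathcal X$, for $k=0,1,2,\dots$: $y^{k+1}$ minimizes over $y\in\mathcal Y$: $f(y)-\langle\mathcal Ax^k,y\rangle+\frac\sigma2\|\mathcal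 A^*y+\mathcal B^*z^k-c\|^2+\frac12\|y-y^k\|_{\mathcal S}^2$; $z^{k+1}$ minimizes over $z\in\mathcal Z$: $g(z)-\langle\mathcal Bx^k,z\rangle+\frac\sigma2\|\rho(\mathcal A^*y^{k+1}+\mathcal B^*z^k-c)+\mathcal B^*(z-z^k)\|^2+\frac12\|z-z^k\|_{\mathcal T}^2$; $x^{k+1}:=x^k-\sigma\big(\rho(\mathcal A^*y^{k+1}+\mathcal B^*z^k-c)+\mathcal B^*(z^{k+1}-z^k)\big)$. (The source states the result for all $k\ge0$ without specifying the element $z^{-1}$ that appears when $k=0$.) Constants and operators. For $\rho\in(0,\frac{1+\sqrt5}2]$: $l_\rho:=\frac1\rho$, $h_\rho:=1-\min\{\rho,\rho^{-1}\}$; for $\rho\in(\frac{1+\sqrt5}2,2)$: $l_\rho:=\frac{2-\rho}{\rho-1}$, $h_\rho:=2-\rho$. Further $m_\rho:=\rho^{-1}(2\min\{\rho,\rho^{-1}\}-\min\{1,\rho^2\})l_\rho$, $n_\rho:=\rho^{-1}(2-\rho)[2(2-\rho)-h_\rho]$, $o_\rho:=(2-\rho)(2-\rho l_\rho)$. $\varepsilon:\mathcal X\to\mathcal U$ is the linear operator whose adjoint is $\varepsilon^*(y,z,x)=\mathcal A^*y+\mathcal B^*z$, $\mathcal I$ is the identity, and $$\mathcal M_\rho:=\begin{pmatrix}\mathcal T+\Sigma_g+\rho^{-1}\sigma\mathcal B\mathcal B^*&\rho^{-1}(1-\rho)\mathcal B\\ \rho^{-1}(1-\rho)\mathcal B^*&(\sigma\rho)^{-1}\mathcal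 I\end{pmatrix},\qquad \mathcal M:=\begin{pmatrix}\mathcal S+\Sigma_f&0\\0&\mathcal M_\rho\end{pmatrix}+\frac14o_\rho\sigma\varepsilon\varepsilon^*.$$ $k_1:=3\|\mathcal S\|$, $k_2:=\max\{\|\mathcal T\|,\ \rho^{-2}(3\lambda_{\max}(\mathcal A\mathcal A^* )\sigma+2(1-\rho)^2\sigma^{-1})\}$, $k_3:=\frac32(1-\rho)^2\rho^{-2}\sigma\lambda_{\max}(\mathcal A\mathcal A^* )+\sigma^{-1}\rho^{-2}$, $k_4:=\max\{k_1,k_2,k_3\}$.
   Formalization: The second estimate is proved for all k ≥ 1 rather than k ≥ 0: at k = 0 it involves the undefined z^{-1} and can fail (e.g. A = B = id on the reals, c = 0, f = 0, g = 2|z|, S = T = 0, Σ_f = Σ_g = 0, ρ = σ = 1, u^0 = (-1,1,0)). *)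

theory Defs
  imports "HOL-Analysis.Analysis"
begin

definition eff_dom :: "('a \<Rightarrow> ereal) \<Rightarrow> 'a set" where
  "eff_dom f = {v. f v < \<infinity>}"

definition ereal_epigraph :: "'a set \<Rightarrow> ('a \<Rightarrow> ereal) \<Rightarrow> ('a \<times> real) set" where
  "ereal_epigraph C f = {(v, r). v \<in> C \<and> f v \<le> ereal r}"

(* Closedness is that of the epigraph. The set C is the whole space, or a linear subspace on
   which alone the values of f matter. *)
definition closed_proper_convex_on :: "'a::euclidean_space set \<Rightarrow> ('a \<Rightarrow> ereal) \<Rightarrow> bool" where
  "closed_proper_convex_on C f \<longleftrightarrow>
     (\<forall>v\<in>C. f v \<noteq> -\<infinity>) \<and> (\<exists>v\<in>C. f v \<noteq> \<infinity>) \<and>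
     convex (ereal_epigraph C f) \<and> closed (ereal_epigraph C f)"

definition subdifferential :: "('a::euclidean_space \<Rightarrow> ereal) \<Rightarrow> 'a \<Rightarrow> 'a set" where
  "subdifferential f v = {\<xi>. \<forall>w. f v + ereal (inner \<xi> (w - v)) \<le> f w}"

definition Prox :: "('a::euclidean_space \<Rightarrow> ereal) \<Rightarrow> 'a \<Rightarrow> 'a" where
  "Prox f v = arg_min (\<lambda>w. f w + ereal (1 / 2 * (norm (w - v))\<^sup>2)) (\<lambda>_. True)"

definition convex_quadratic :: "('a::euclidean_space \<Rightarrow> real) \<Rightarrow> bool" where
  "convex_quadratic q \<longleftrightarrow> convex_on UNIV q \<and>
     (\<exists>Q b r. linear Q \<and> adjoint Q = Q \<and> (\<forall>v. q v = 1 / 2 * inner v (Q v) + inner b v + r))"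

(* The product of m Euclidean spaces is given as the internal orthogonal direct sum of
   subspaces V 1, ..., V m; a vector (v_1, ..., v_m) is the sum of its blocks v_i in V i. *)
definition orthogonal_blocks :: "nat \<Rightarrow> (nat \<Rightarrow> 'a::euclidean_space set) \<Rightarrow> bool" where
  "orthogonal_blocks m V \<longleftrightarrow> 1 \<le> m \<and>
     (\<forall>i\<in>{1..m}. subspace (V i)) \<and>
     (\<forall>i\<in>{1..m}. \<forall>j\<in>{1..m}. i \<noteq> j \<longrightarrow> (\<forall>v\<in>V i. \<forall>w\<in>V j. orthogonal v w)) \<and>
     span (\<Union>i\<in>{1..m}. V i) = UNIV"

(* f(v_1, ..., v_m) = f1(v_1) + f2(v_1, ..., v_m). *)
definition composite_form ::
  "nat \<Rightarrow> (nat \<Rightarrow> 'a::euclidean_space set) \<Rightarrow> ('a \<Rightarrow> ereal) \<Rightarrow> ('a \<Rightarrow> ereal) \<Rightarrow> ('a \<Rightarrow> real) \<Rightarrow> bool"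
where
  "composite_form m V f f1 f2 \<longleftrightarrow>
     (\<forall>v. (\<forall>i\<in>{1..m}. v i \<in> V i) \<longrightarrow>
        f (\<Sum>i=1..m. v i) = f1 (v 1) + ereal (f2 (\<Sum>i=1..m. v i)))"

definition psd_operator :: "('a::euclidean_space \<Rightarrow> 'a) \<Rightarrow> bool" where
  "psd_operator G \<longleftrightarrow> linear G \<and> adjoint G = G \<and> (\<forall>v. 0 \<le> inner v (G v))"

definition pd_operator :: "('a::euclidean_space \<Rightarrow> 'a) \<Rightarrow> bool" where
  "pd_operator G \<longleftrightarrow> linear G \<and> adjoint G = G \<and> (\<forall>v. v \<noteq> 0 \<longrightarrow> 0 < inner v (G v))"

definition op_norm_wrt :: "('a::euclidean_space \<Rightarrow> 'a) \<Rightarrow> 'a \<Rightarrow> real" where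
  "op_norm_wrt G v = sqrt (inner v (G v))"

definition op_dist_wrt :: "('a::euclidean_space \<Rightarrow> 'a) \<Rightarrow> 'a \<Rightarrow> 'a set \<Rightarrow> real" where
  "op_dist_wrt G u C = (INF v\<in>C. op_norm_wrt G (u - v))"

definition lambda_max :: "('a::euclidean_space \<Rightarrow> 'a) \<Rightarrow> real" where
  "lambda_max G = Max {l. \<exists>v. v \<noteq> 0 \<and> G v = l *\<^sub>R v}"

definition monotone_modulus ::
  "('a::euclidean_space \<Rightarrow> ereal) \<Rightarrow> ('a \<Rightarrow> 'a) \<Rightarrow> bool" where
  "monotone_modulus f G \<longleftrightarrow>
     (\<forall>v\<in>eff_dom f. \<forall>v'\<in>eff_dom f. \<forall>\<xi>\<in>subdifferential f v. \<forall>\<xi>'\<in>subdifferential f v'.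
        inner (\<xi>' - \<xi>) (v' - v) \<ge> (op_norm_wrt G (v' - v))\<^sup>2)"

definition piecewise_polyhedral ::
  "('a::euclidean_space \<Rightarrow> 'b::euclidean_space) \<Rightarrow> bool" where
  "piecewise_polyhedral F \<longleftrightarrow>
     (\<exists>\<P>. finite \<P> \<and> (\<forall>P\<in>\<P>. polyhedron P) \<and> {(u, F u) | u. True} = \<Union>\<P>)"

definition KKT_points ::
  "('y::euclidean_space \<Rightarrow> ereal) \<Rightarrow> ('z::euclidean_space \<Rightarrow> ereal) \<Rightarrow>
   ('x::euclidean_space \<Rightarrow> 'y) \<Rightarrow> ('x \<Rightarrow> 'z) \<Rightarrow> 'x \<Rightarrow> ('y \<times> 'z \<times> 'x) set" where
  "KKT_points f g A B c =
     {(y, z, x). A x \<in> subdifferential f y \<and> B x \<in> subdifferential g z \<and>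
        adjoint A y + adjoint B z - c = 0}"

definition KKT_map ::
  "('y::euclidean_space \<Rightarrow> ereal) \<Rightarrow> ('z::euclidean_space \<Rightarrow> ereal) \<Rightarrow>
   ('x::euclidean_space \<Rightarrow> 'y) \<Rightarrow> ('x \<Rightarrow> 'z) \<Rightarrow> 'x \<Rightarrow> 'y \<times> 'z \<times> 'x \<Rightarrow> 'y \<times> 'z \<times> 'x" where
  "KKT_map f g A B c = (\<lambda>(y, z, x).
     (y - Prox f (y + A x), z - Prox g (z + B x), adjoint A y + adjoint B z - c))"

definition sPGADMM ::
  "('y::euclidean_space \<Rightarrow> ereal) \<Rightarrow> ('z::euclidean_space \<Rightarrow> ereal) \<Rightarrow>
   ('x::euclidean_space \<Rightarrow> 'y) \<Rightarrow> ('x \<Rightarrow> 'z) \<Rightarrow> 'x \<Rightarrow>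
   ('y \<Rightarrow> 'y) \<Rightarrow> ('z \<Rightarrow> 'z) \<Rightarrow> real \<Rightarrow> real \<Rightarrow>
   (nat \<Rightarrow> 'y) \<Rightarrow> (nat \<Rightarrow> 'z) \<Rightarrow> (nat \<Rightarrow> 'x) \<Rightarrow> bool" where
  "sPGADMM f g A B c S T \<rho> \<sigma> ys zs xs \<longleftrightarrow>
     ys 0 \<in> eff_dom f \<and> zs 0 \<in> eff_dom g \<and>
     (\<forall>k.
        is_arg_min
          (\<lambda>y. f y + ereal (- inner (A (xs k)) y
             + \<sigma> / 2 * (norm (adjoint A y + adjoint B (zs k) - c))\<^sup>2
             + 1 / 2 * (op_norm_wrt S (y - ys k))\<^sup>2))
          (\<lambda>_. True) (ys (Suc k)) \<and>
        is_arg_min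
          (\<lambda>z. g z + ereal (- inner (B (xs k)) z
             + \<sigma> / 2 * (norm (\<rho> *\<^sub>R (adjoint A (ys (Suc k)) + adjoint B (zs k) - c)
                            + adjoint B (z - zs k)))\<^sup>2
             + 1 / 2 * (op_norm_wrt T (z - zs k))\<^sup>2))
          (\<lambda>_. True) (zs (Suc k)) \<and>
        xs (Suc k) = xs k - \<sigma> *\<^sub>R
          (\<rho> *\<^sub>R (adjoint A (ys (Suc k)) + adjoint B (zs k) - c)
             + adjoint B (zs (Suc k) - zs k)))"

definition l_const :: "real \<Rightarrow> real" where
  "l_const \<rho> = (if \<rho> \<le> (1 + sqrt 5) / 2 then 1 / \<rho> else (2 - \<rho>) / (\<rho> - 1))"

definition h_const :: "real \<Rightarrow> real" where
  "h_const \<rho> = (if \<rho> \<le> (1 + sqrt 5) / 2 then 1 - min \<rho> (1 / \<rho>) else 2 - \<rho>)"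

definition m_const :: "real \<Rightarrow> real" where
  "m_const \<rho> = 1 / \<rho> * (2 * min \<rho> (1 / \<rho>) - min 1 (\<rho>\<^sup>2)) * l_const \<rho>"

definition n_const :: "real \<Rightarrow> real" where
  "n_const \<rho> = 1 / \<rho> * (2 - \<rho>) * (2 * (2 - \<rho>) - h_const \<rho>)"

definition o_const :: "real \<Rightarrow> real" where
  "o_const \<rho> = (2 - \<rho>) * (2 - \<rho> * l_const \<rho>)"

definition eps_adj ::
  "('x::euclidean_space \<Rightarrow> 'y::euclidean_space) \<Rightarrow> ('x \<Rightarrow> 'z::euclidean_space) \<Rightarrow>
   'y \<times> 'z \<times> 'x \<Rightarrow> 'x" where
  "eps_adj A B = (\<lambda>(y, z, x). adjoint A y + adjoint B z)"

definition eps ::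
  "('x::euclidean_space \<Rightarrow> 'y::euclidean_space) \<Rightarrow> ('x \<Rightarrow> 'z::euclidean_space) \<Rightarrow>
   'x \<Rightarrow> 'y \<times> 'z \<times> 'x" where
  "eps A B = adjoint (eps_adj A B)"

definition M_rho_op ::
  "('x::euclidean_space \<Rightarrow> 'z::euclidean_space) \<Rightarrow> ('z \<Rightarrow> 'z) \<Rightarrow> ('z \<Rightarrow> 'z) \<Rightarrow>
   real \<Rightarrow> real \<Rightarrow> 'z \<times> 'x \<Rightarrow> 'z \<times> 'x" where
  "M_rho_op B T Sg \<rho> \<sigma> = (\<lambda>(z, x).
     (T z + Sg z + (1 / \<rho> * \<sigma>) *\<^sub>R B (adjoint B z) + (1 / \<rho> * (1 - \<rho>)) *\<^sub>R B x,
      (1 / \<rho> * (1 - \<rho>)) *\<^sub>R adjoint B z + (1 / (\<sigma> * \<rho>)) *\<^sub>R x))"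

definition M_op ::
  "('x::euclidean_space \<Rightarrow> 'y::euclidean_space) \<Rightarrow> ('x \<Rightarrow> 'z::euclidean_space) \<Rightarrow>
   ('y \<Rightarrow> 'y) \<Rightarrow> ('z \<Rightarrow> 'z) \<Rightarrow> ('y \<Rightarrow> 'y) \<Rightarrow> ('z \<Rightarrow> 'z) \<Rightarrow>
   real \<Rightarrow> real \<Rightarrow> 'y \<times> 'z \<times> 'x \<Rightarrow> 'y \<times> 'z \<times> 'x" where
  "M_op A B S T Sf Sg \<rho> \<sigma> = (\<lambda>(y, z, x).
     (S y + Sf y, M_rho_op B T Sg \<rho> \<sigma> (z, x))
       + (1 / 4 * o_const \<rho> * \<sigma>) *\<^sub>R eps A B (eps_adj A B (y, z, x)))"

definition Mbar_op ::
  "('x::euclidean_space \<Rightarrow> 'y::euclidean_space) \<Rightarrow> ('x \<Rightarrow> 'z::euclidean_space) \<Rightarrow>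
   ('y \<Rightarrow> 'y) \<Rightarrow> ('z \<Rightarrow> 'z) \<Rightarrow> ('y \<Rightarrow> 'y) \<Rightarrow> ('z \<Rightarrow> 'z) \<Rightarrow>
   real \<Rightarrow> real \<Rightarrow> 'y \<times> 'z \<times> 'x \<Rightarrow> 'y \<times> 'z \<times> 'x" where
  "Mbar_op A B S T Sf Sg \<rho> \<sigma> = (\<lambda>u. (\<rho> / (2 - \<rho>)) *\<^sub>R M_op A B S T Sf Sg \<rho> \<sigma> u)"

definition k1_const :: "('y::euclidean_space \<Rightarrow> 'y) \<Rightarrow> real" where
  "k1_const S = 3 * onorm S"

definition k2_const ::
  "('x::euclidean_space \<Rightarrow> 'y::euclidean_space) \<Rightarrow> ('z::euclidean_space \<Rightarrow> 'z) \<Rightarrow>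
   real \<Rightarrow> real \<Rightarrow> real" where
  "k2_const A T \<rho> \<sigma> =
     max (onorm T)
       (1 / \<rho>\<^sup>2 * (3 * lambda_max (A \<circ> adjoint A) * \<sigma> + 2 * (1 - \<rho>)\<^sup>2 * (1 / \<sigma>)))"

definition k3_const ::
  "('x::euclidean_space \<Rightarrow> 'y::euclidean_space) \<Rightarrow> real \<Rightarrow> real \<Rightarrow> real" where
  "k3_const A \<rho> \<sigma> =
     3 / 2 * (1 - \<rho>)\<^sup>2 * (1 / \<rho>\<^sup>2) * \<sigma> * lambda_max (A \<circ> adjoint A) + 1 / \<sigma> * (1 / \<rho>\<^sup>2)"

definition k4_const ::
  "('x::euclidean_space \<Rightarrow> 'y::euclidean_space) \<Rightarrow> ('y \<Rightarrow> 'y) \<Rightarrow>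
   ('z::euclidean_space \<Rightarrow> 'z) \<Rightarrow> real \<Rightarrow> real \<Rightarrow> real" where
  "k4_const A S T \<rho> \<sigma> = max (k1_const S) (max (k2_const A T \<rho> \<sigma>) (k3_const A \<rho> \<sigma>))"

definition k5_hat ::
  "('x::euclidean_space \<Rightarrow> 'y::euclidean_space) \<Rightarrow> ('x \<Rightarrow> 'z::euclidean_space) \<Rightarrow>
   ('y \<Rightarrow> 'y) \<Rightarrow> ('z \<Rightarrow> 'z) \<Rightarrow> ('y \<Rightarrow> 'y) \<Rightarrow> ('z \<Rightarrow> 'z) \<Rightarrow>
   real \<Rightarrow> real \<Rightarrow> real \<Rightarrow> real" where
  "k5_hat A B S T Sf Sg \<rho> \<sigma> \<kappa> =
     min 1 (min (m_const \<rho>) (1 / 2 * n_const \<rho>)) * inverse (k4_const A S T \<rho> \<sigma>)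
       * \<rho> * inverse (2 - \<rho>) * inverse (\<kappa>\<^sup>2)
       * inverse (lambda_max (Mbar_op A B S T Sf Sg \<rho> \<sigma>))"

definition theta_hat ::
  "('x::euclidean_space \<Rightarrow> 'y::euclidean_space) \<Rightarrow> ('x \<Rightarrow> 'z::euclidean_space) \<Rightarrow>
   ('y \<Rightarrow> 'y) \<Rightarrow> ('z \<Rightarrow> 'z) \<Rightarrow> ('y \<Rightarrow> 'y) \<Rightarrow> ('z \<Rightarrow> 'z) \<Rightarrow>
   real \<Rightarrow> real \<Rightarrow> real \<Rightarrow> real" where
  "theta_hat A B S T Sf Sg \<rho> \<sigma> \<kappa> =
     (let k5 = k5_hat A B S T Sf Sg \<rho> \<sigma> \<kappa>
      in inverse (1 + k5 * \<rho> * inverse (\<rho> + (2 - \<rho>) * k5)))"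

end

theory Submission
  imports Defs
begin

text \<open>
  The constant \<open>\<kappa>\<close> of the theorem may be taken as large as one likes: the error bound only gets weaker,
  and the prescribed factor \<open>theta_hat\<close> tends to 1 as \<open>\<kappa>\<close> grows (\<open>theta_hat_tendsto_1\<close>). So it
  is enough to find some error bound along the iterates, and some factor \<open>q < 1\<close> by which the function
  in the second claim (the squared \<open>Mbar\<close>-distance to the KKT points plus the squared \<open>T\<close>-norm of the
  last increment of \<open>z\<close>) decreases in each step.

  The error bound follows from polyhedrality. A convergent sequence is bounded, and on a bounded set a
  map with a zero whose graph is a finite union of polyhedra satisfies a linear error bound
  (\<open>piecewise_polyhedral_error_bound\<close>), by Hoffman's inequality on each piece
  (\<open>polyhedron_linear_error_bound\<close>). The zeros of the KKT map are the KKT points (\<open>KKT_map_zeros\<close>),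
  because \<open>y = Prox f (y + \<eta>)\<close> means that \<open>\<eta>\<close> is a subgradient at \<open>y\<close>.

  The decrease follows from monotonicity. The variable \<open>x + \<sigma> *\<^sub>R adjoint B z\<close> performs a relaxed
  Douglas-Rachford step, and combining the subgradient inequalities of the two subproblems at a solution
  and at consecutive \<open>z\<close> gives a decrease by a multiple of a quantity \<open>progress\<close>
  (\<open>inner_M_op_descent\<close>, \<open>descent_to_KKT_point\<close>). The same quantity bounds the squared KKT
  residual at the new iterate (\<open>KKT_map_norm_square_le_progress\<close>), since the proximal map is
  nonexpansive. By the error bound it therefore bounds the new value of the decreasing function, which
  gives the factor \<open>q\<close> (\<open>lyapunov_linear_rate\<close>).
\<close>

section \<open>Error bounds for polyhedra and piecewise polyhedral maps\<close>

text \<open>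
  This is Hoffman's bound for a polyhedron \<open>P\<close> cut by the kernel of a linear map, and it comes from
  compactness. Let \<open>p\<close> be the nearest point to \<open>q\<close> in the cut and \<open>d = q - p\<close>. The tangent cone
  of \<open>P\<close> at \<open>p\<close> depends only on the set of inequalities active at \<open>p\<close>, so only finitely
  many cones \<open>C G\<close> occur. The vector \<open>d\<close> lies in such a cone and makes an obtuse angle with every
  direction of the cone killed by \<open>h\<close>; in particular \<open>h d = 0\<close> would force \<open>d \<bullet> d \<le> 0\<close>.
  Hence \<open>norm (h d)\<close> is bounded away from zero on the compact set of unit vectors with these two
  properties.
\<close>

lemma polyhedron_linear_error_bound:
  fixes P :: "'a::euclidean_space set" and h :: "'a \<Rightarrow> 'b::euclidean_space"
  assumes P: "polyhedron P" and h: "linear h" and ne: "{q \<in> P. h q = 0} \<noteq> {}"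
  obtains \<kappa> where "\<kappa> > 0" "\<And>q. q \<in> P \<Longrightarrow> infdist q {q \<in> P. h q = 0} \<le> \<kappa> * norm (h q)"
proof -
  obtain F where F: "finite F" "P = \<Inter>F" "\<forall>H\<in>F. \<exists>a b. a \<noteq> 0 \<and> H = {x. a \<bullet> x \<le> b}"
    using P unfolding polyhedron_def by auto
  then obtain a b where ab: "\<And>H. H \<in> F \<Longrightarrow> H = {x. a H \<bullet> x \<le> b H}"
    by metis
  have P_iff: "q \<in> P \<longleftrightarrow> (\<forall>H\<in>F. a H \<bullet> q \<le> b H)" for q
    using F(2) ab by blast
  have cont_h: "continuous_on X h" for X
    using h by (simp add: linear_continuous_on linear_linear)
  define Z where "Z = {q \<in> P. h q = 0}"
  have Z_eq: "Z = P \<inter> h -` {0}"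
    by (auto simp: Z_def)
  have "closed Z"
    unfolding Z_eq using polyhedron_imp_closed[OF P] cont_h[of UNIV]
    by (intro closed_Int) (auto intro: closed_vimage simp: continuous_on_eq_continuous_at)
  have "convex Z"
    unfolding Z_eq using polyhedron_imp_convex[OF P] h
    by (intro convex_Int) (auto intro: convex_linear_vimage)
  \<comment> \<open>Tangent cone at a point whose active inequalities are \<open>G\<close>, and its unit vectors polar to the kernel.\<close>
  define C where "C G = {d. \<forall>H\<in>G. a H \<bullet> d \<le> 0}" for G
  define K where "K G = {d. norm d = 1 \<and> d \<in> C G \<and> (\<forall>s\<in>C G. h s = 0 \<longrightarrow> d \<bullet> s \<le> 0)}" for G
  have "\<exists>\<kappa>>0. \<forall>d\<in>K G. 1 \<le> \<kappa> * norm (h d)" for G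
  proof (cases "K G = {}")
    case True
    then show ?thesis by (auto intro: exI[of _ 1])
  next
    case False
    have "closed (K G)"
      unfolding K_def C_def mem_Collect_eq Ball_def
      by (intro closed_Collect_conj closed_Collect_all closed_Collect_imp closed_Collect_eq
          closed_Collect_le continuous_intros open_Collect_const)
    moreover have "bounded (K G)"
      by (rule bounded_subset[of "cball 0 1"]) (auto simp: K_def)
    ultimately have "compact (K G)"
      by (simp add: compact_eq_bounded_closed)
    then obtain d where d: "d \<in> K G" "\<And>e. e \<in> K G \<Longrightarrow> norm (h d) \<le> norm (h e)"
      using continuous_attains_inf[OF _ False continuous_on_norm[OF cont_h]] by metis
    have "h d \<noteq> 0"
    proof
      assume "h d = 0"
      then have "d \<bullet> d \<le> 0"
        using d(1) by (auto simp: K_def)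
      then show False
        using d(1) by (auto simp: K_def dot_square_norm)
    qed
    then show ?thesis
      using d(2) by (intro exI[of _ "1 / norm (h d)"]) (auto simp: field_simps)
  qed
  then obtain \<kappa> where \<kappa>: "\<And>G. \<kappa> G > 0" "\<And>G d. d \<in> K G \<Longrightarrow> 1 \<le> \<kappa> G * norm (h d)"
    by metis
  define \<kappa>0 where "\<kappa>0 = sum \<kappa> (Pow F)"
  have \<kappa>0: "\<kappa> G \<le> \<kappa>0" if "G \<subseteq> F" for G
    unfolding \<kappa>0_def using that F(1) \<kappa>(1) by (intro member_le_sum) (auto intro: less_imp_le)
  have "\<kappa>0 > 0"
    using \<kappa>0[of "{}"] \<kappa>(1)[of "{}"] by simp
  moreover have "infdist q Z \<le> \<kappa>0 * norm (h q)" if q: "q \<in> P" for q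
  proof -
    define p where "p = closest_point Z q"
    have p: "p \<in> Z"
      unfolding p_def using \<open>closed Z\<close> ne by (intro closest_point_in_set) (auto simp: Z_def)
    define d where "d = q - p"
    have le: "infdist q Z \<le> norm d"
      using infdist_le[OF p] by (simp add: d_def dist_norm)
    have hd: "h d = h q"
      using p by (simp add: d_def Z_def linear_diff[OF h])
    show ?thesis
    proof (cases "d = 0")
      case True
      then show ?thesis using le \<open>\<kappa>0 > 0\<close> by (smt (verit) norm_zero norm_ge_zero mult_nonneg_nonneg)
    next
      case False
      define G where "G = {H \<in> F. a H \<bullet> p = b H}"
      have dC: "d \<in> C G"
        using q by (auto simp: C_def G_def d_def inner_diff_right P_iff)
      have "d \<bullet> s \<le> 0" if s: "s \<in> C G" "h s = 0" for s
      proof -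
        \<comment> \<open>Inactive inequalities survive a short step along \<open>s\<close>, so that step stays in the cut.\<close>
        have "\<forall>H\<in>F. \<forall>\<^sub>F t in at_right (0::real). a H \<bullet> (p + t *\<^sub>R s) \<le> b H"
        proof
          fix H assume H: "H \<in> F"
          show "\<forall>\<^sub>F t in at_right (0::real). a H \<bullet> (p + t *\<^sub>R s) \<le> b H"
          proof (cases "H \<in> G")
            case True
            then have "a H \<bullet> s \<le> 0" "a H \<bullet> p = b H"
              using s by (auto simp: C_def G_def)
            then show ?thesis
              by (auto intro!: eventually_at_rightI[of 0 1] simp: inner_add_right mult_nonneg_nonpos)
          next
            case False
            have "((\<lambda>t. a H \<bullet> (p + t *\<^sub>R s)) \<longlongrightarrow> a H \<bullet> (p + 0 *\<^sub>R s)) (at_right 0)"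
              by (intro tendsto_intros)
            moreover have "a H \<bullet> (p + 0 *\<^sub>R s) < b H"
              using False H p by (auto simp: G_def Z_def P_iff order_less_le)
            ultimately have "\<forall>\<^sub>F t in at_right (0::real). a H \<bullet> (p + t *\<^sub>R s) < b H"
              by (rule order_tendstoD(2))
            then show ?thesis
              by eventually_elim simp
          qed
        qed
        then have "\<forall>\<^sub>F t in at_right (0::real). \<forall>H\<in>F. a H \<bullet> (p + t *\<^sub>R s) \<le> b H"
          using F(1) by (simp add: eventually_ball_finite)
        moreover have "\<forall>\<^sub>F t in at_right (0::real). t > 0"
          by (simp add: eventually_at_right_less)
        ultimately have "\<forall>\<^sub>F t in at_right (0::real). t > 0 \<and> (\<forall>H\<in>F. a H \<bullet> (p + t *\<^sub>R s) \<le> b H)"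
          by (rule eventually_conj[rotated])
        then obtain t :: real where t: "t > 0" "\<forall>H\<in>F. a H \<bullet> (p + t *\<^sub>R s) \<le> b H"
          using eventually_happens'[OF trivial_limit_at_right_real] by blast
        have "p + t *\<^sub>R s \<in> Z"
          using t p s by (simp add: Z_def P_iff linear_add[OF h] linear_scale[OF h])
        from closest_point_dot[OF \<open>convex Z\<close> \<open>closed Z\<close> this, of q]
        have "t * (d \<bullet> s) \<le> 0"
          by (simp add: p_def d_def)
        then show ?thesis
          using t(1) by (simp add: mult_le_0_iff)
      qed
      then have "d /\<^sub>R norm d \<in> K G"
        using False dC by (auto simp: K_def C_def mult_nonneg_nonpos)
      from \<kappa>(2)[OF this] have "norm d \<le> \<kappa> G * norm (h d)"
        using False by (simp add: linear_scale[OF h] field_simps)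
      also have "\<dots> \<le> \<kappa>0 * norm (h q)"
        unfolding hd by (intro mult_right_mono \<kappa>0) (auto simp: G_def)
      finally show ?thesis
        using le by linarith
    qed
  qed
  ultimately show ?thesis
    using that unfolding Z_def by blast
qed

text \<open>
  On each polyhedral piece of the graph that meets the plane \<open>F u = 0\<close>, Hoffman's bound applies to
  the projection to the second factor. A piece that misses this plane stays away from it over a
  bounded set, and there the residual is bounded below while the distance is bounded above.
\<close>

lemma piecewise_polyhedral_error_bound:
  fixes F :: "'a::euclidean_space \<Rightarrow> 'b::euclidean_space"
  assumes pp: "piecewise_polyhedral F" and u0: "F u0 = 0" and X: "bounded X"
  obtains \<kappa> where "\<kappa> > 0" "\<And>u. u \<in> X \<Longrightarrow> infdist u {u. F u = 0} \<le> \<kappa> * norm (F u)"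
proof -
  obtain \<P> where \<P>: "finite \<P>" "\<And>P. P \<in> \<P> \<Longrightarrow> polyhedron P" "{(u, F u) | u. True} = \<Union>\<P>"
    using pp unfolding piecewise_polyhedral_def by auto
  obtain D where D: "\<And>u. u \<in> X \<Longrightarrow> dist u u0 \<le> D"
    using X by (metis bounded_any_center dist_commute)
  have "\<exists>\<kappa>>0. \<forall>u\<in>X. (u, F u) \<in> P \<longrightarrow> infdist u {u. F u = 0} \<le> \<kappa> * norm (F u)"
    if P: "P \<in> \<P>" for P
  proof (cases "{q \<in> P. snd q = 0} = {}")
    case False
    then obtain \<kappa> where \<kappa>: "\<kappa> > 0"
      "\<And>q. q \<in> P \<Longrightarrow> infdist q {q \<in> P. snd q = 0} \<le> \<kappa> * norm (snd q)"
      using polyhedron_linear_error_bound[OF \<P>(2)[OF P] linear_snd] by metis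
    have "infdist u {u. F u = 0} \<le> infdist (u, F u) {q \<in> P. snd q = 0}" for u
      unfolding infdist_notempty[OF False]
    proof (rule cINF_greatest[OF False])
      fix q assume "q \<in> {q \<in> P. snd q = 0}"
      moreover from this have "q \<in> {(u, F u) | u. True}"
        using \<P>(3) P by blast
      ultimately obtain v where v: "q = (v, 0)" "F v = 0"
        by auto
      have "infdist u {u. F u = 0} \<le> dist u v"
        using v by (intro infdist_le) auto
      also have "\<dots> \<le> dist (u, F u) q"
        using dist_fst_le[of "(u, F u)" q] v by simp
      finally show "infdist u {u. F u = 0} \<le> dist (u, F u) q" .
    qed
    moreover have "infdist (u, F u) {q \<in> P. snd q = 0} \<le> \<kappa> * norm (F u)" if "(u, F u) \<in> P" for u
      using \<kappa>(2)[OF that] by simp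
    ultimately show ?thesis
      using \<kappa>(1) by (meson order_trans)
  next
    case True
    define K where "K = P \<inter> (closure X \<times> cball 0 1)"
    have "compact K"
      unfolding K_def using X polyhedron_imp_closed[OF \<P>(2)[OF P]]
      by (intro closed_Int_compact compact_Times) auto
    have "\<exists>\<eta>>0. \<forall>q\<in>K. \<eta> \<le> norm (snd q)"
    proof (cases "K = {}")
      case False
      have "continuous_on K (\<lambda>q. norm (snd q))"
        by (intro continuous_intros)
      from continuous_attains_inf[OF \<open>compact K\<close> False this] obtain q where
        "q \<in> K" "\<And>r. r \<in> K \<Longrightarrow> norm (snd q) \<le> norm (snd r)"
        by metis
      with True show ?thesis
        by (intro exI[of _ "norm (snd q)"]) (auto simp: K_def)
    qed (auto intro: exI[of _ 1])
    then obtain \<eta> where \<eta>: "\<eta> > 0" "\<And>q. q \<in> K \<Longrightarrow> \<eta> \<le> norm (snd q)"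
      by blast
    define \<kappa> where "\<kappa> = (\<bar>D\<bar> + 1) / min 1 \<eta>"
    have "\<kappa> > 0"
      using \<eta>(1) by (simp add: \<kappa>_def)
    moreover have "infdist u {u. F u = 0} \<le> \<kappa> * norm (F u)" if u: "u \<in> X" "(u, F u) \<in> P" for u
    proof -
      have "min 1 \<eta> \<le> norm (F u)"
      proof (cases "norm (F u) \<le> 1")
        case True
        then have "(u, F u) \<in> K"
          using u closure_subset by (auto simp: K_def)
        then show ?thesis using \<eta>(2) by fastforce
      qed auto
      then have "\<kappa> * min 1 \<eta> \<le> \<kappa> * norm (F u)"
        using \<open>\<kappa> > 0\<close> by (intro mult_left_mono) auto
      moreover have "\<kappa> * min 1 \<eta> = \<bar>D\<bar> + 1"
        using \<eta>(1) by (simp add: \<kappa>_def)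
      moreover have "infdist u {u. F u = 0} \<le> dist u u0"
        using u0 by (intro infdist_le) auto
      ultimately show ?thesis
        using D[OF u(1)] by linarith
    qed
    ultimately show ?thesis by blast
  qed
  then obtain \<kappa> where \<kappa>: "\<And>P. P \<in> \<P> \<Longrightarrow> \<kappa> P > 0"
    "\<And>P u. P \<in> \<P> \<Longrightarrow> u \<in> X \<Longrightarrow> (u, F u) \<in> P \<Longrightarrow> infdist u {u. F u = 0} \<le> \<kappa> P * norm (F u)"
    by metis
  show ?thesis
  proof (rule that[of "1 + sum \<kappa> \<P>"])
    show "1 + sum \<kappa> \<P> > 0"
      by (smt (verit) \<kappa>(1) sum_nonneg)
    fix u assume u: "u \<in> X"
    obtain P where P: "P \<in> \<P>" "(u, F u) \<in> P"
      using \<P>(3) by blast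
    have "\<kappa> P \<le> sum \<kappa> \<P>"
      using P \<P>(1) \<kappa>(1) by (intro member_le_sum) (auto intro: less_imp_le)
    then have "\<kappa> P * norm (F u) \<le> (1 + sum \<kappa> \<P>) * norm (F u)"
      by (intro mult_right_mono) auto
    then show "infdist u {u. F u = 0} \<le> (1 + sum \<kappa> \<P>) * norm (F u)"
      using \<kappa>(2)[OF P(1) u P(2)] by linarith
  qed
qed

section \<open>Subgradients and the proximal map\<close>

lemma closed_proper_convex_finite_point:
  assumes "closed_proper_convex_on UNIV f"
  obtains w r where "f w = ereal r"
proof -
  obtain w where "f w \<noteq> \<infinity>" "f w \<noteq> -\<infinity>"
    using assms unfolding closed_proper_convex_on_def by blast
  then show ?thesis
    using that by (cases "f w") auto
qed

lemma subdifferential_finite: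
  assumes f: "closed_proper_convex_on UNIV f" and \<xi>: "\<xi> \<in> subdifferential f p"
  obtains r where "f p = ereal r"
proof -
  obtain w s where w: "f w = ereal s"
    using closed_proper_convex_finite_point[OF f] .
  have "f p + ereal (\<xi> \<bullet> (w - p)) \<le> ereal s"
    using \<xi> w unfolding subdifferential_def by (metis (no_types, lifting) mem_Collect_eq)
  moreover have "f p \<noteq> -\<infinity>"
    using f unfolding closed_proper_convex_on_def by auto
  ultimately show ?thesis
    using that by (cases "f p") auto
qed

lemma subdifferential_eff_dom:
  assumes "closed_proper_convex_on UNIV f" and "\<xi> \<in> subdifferential f p"
  shows "p \<in> eff_dom f"
proof -
  obtain r where "f p = ereal r"
    using subdifferential_finite[OF assms] .
  then show ?thesis
    by (simp add: eff_dom_def)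
qed

lemma subdifferential_monotone:
  assumes f: "closed_proper_convex_on UNIV f"
    and \<xi>: "\<xi> \<in> subdifferential f p" and \<eta>: "\<eta> \<in> subdifferential f q"
  shows "0 \<le> (\<xi> - \<eta>) \<bullet> (p - q)"
proof -
  obtain r s where rs: "f p = ereal r" "f q = ereal s"
    using subdifferential_finite[OF f \<xi>] subdifferential_finite[OF f \<eta>] by metis
  have "f p + ereal (\<xi> \<bullet> (q - p)) \<le> f q" "f q + ereal (\<eta> \<bullet> (p - q)) \<le> f p"
    using \<xi> \<eta> by (auto simp: subdifferential_def)
  then show ?thesis
    by (simp add: rs inner_diff)
qed

text \<open>
  Fermat's rule for a convex function plus a quadratic. Convexity on the segment from \<open>p\<close> to \<open>w\<close>
  turns minimality into an inequality for the difference quotient, whose limit at \<open>p\<close> is the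
  subgradient inequality. The hypothesis is the exact second order expansion of \<open>q\<close>, with \<open>G\<close> its
  gradient at \<open>p\<close>; it covers both the proximal objective and the two subproblems of the algorithm.
\<close>

lemma subgradient_of_minimizer:
  fixes f :: "'a::euclidean_space \<Rightarrow> ereal" and q :: "'a \<Rightarrow> real"
  assumes f: "closed_proper_convex_on UNIV f"
    and min: "is_arg_min (\<lambda>w. f w + ereal (q w)) (\<lambda>_. True) p"
    and q: "\<And>d t. q (p + t *\<^sub>R d) = q p + t * (G \<bullet> d) + t\<^sup>2 * H d"
  shows "- G \<in> subdifferential f p"
proof -
  have min': "f p + ereal (q p) \<le> f w + ereal (q w)" for w
    using min unfolding is_arg_min_def by (meson not_le)
  obtain w0 s0 where "f w0 = ereal s0"
    using closed_proper_convex_finite_point[OF f] .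
  then have "f p \<noteq> \<infinity>"
    using min'[of w0] by auto
  moreover have ninf: "f w \<noteq> -\<infinity>" for w
    using f unfolding closed_proper_convex_on_def by auto
  ultimately obtain r where r: "f p = ereal r"
    by (cases "f p") auto
  have "f p + ereal (- G \<bullet> (w - p)) \<le> f w" for w
  proof (cases "f w")
    case (real s)
    define d where "d = w - p"
    have "0 \<le> (s - r + G \<bullet> d) + t * H d" if t: "0 < t" "t < 1" for t
    proof -
      have "(p, r) \<in> ereal_epigraph UNIV f" "(w, s) \<in> ereal_epigraph UNIV f"
        using r real by (auto simp: ereal_epigraph_def)
      then have "(1 - t) *\<^sub>R (p, r) + t *\<^sub>R (w, s) \<in> ereal_epigraph UNIV f"
        using f t unfolding closed_proper_convex_on_def
        by (intro convexD) auto
      moreover have "(1 - t) *\<^sub>R p + t *\<^sub>R w = p + t *\<^sub>R d"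
        by (simp add: d_def algebra_simps)
      ultimately have "f (p + t *\<^sub>R d) \<le> ereal ((1 - t) * r + t * s)"
        by (simp add: ereal_epigraph_def)
      then have "f (p + t *\<^sub>R d) + ereal (q (p + t *\<^sub>R d))
          \<le> ereal ((1 - t) * r + t * s) + ereal (q (p + t *\<^sub>R d))"
        by (intro add_right_mono)
      then have "r + q p \<le> (1 - t) * r + t * s + q (p + t *\<^sub>R d)"
        using min'[of "p + t *\<^sub>R d"] r by (metis order_trans plus_ereal.simps(1) ereal_less_eq(3))
      then have "0 \<le> t * ((s - r + G \<bullet> d) + t * H d)"
        unfolding q by (simp add: algebra_simps power2_eq_square)
      then show ?thesis
        using t by (simp add: zero_le_mult_iff)
    qed
    moreover have "((\<lambda>t. (s - r + G \<bullet> d) + t * H d) \<longlongrightarrow> (s - r + G \<bullet> d) + 0 * H d) (at_right 0)"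
      by (intro tendsto_intros)
    ultimately have "0 \<le> (s - r + G \<bullet> d) + 0 * H d"
      by (intro tendsto_lowerbound[where F = "at_right (0::real)"])
        (auto intro: eventually_at_rightI[of 0 1])
    then show ?thesis
      by (simp add: r real d_def)
  qed (use ninf in auto)
  then show ?thesis
    by (simp add: subdifferential_def)
qed

text \<open>
  A hyperplane separating the epigraph from a point just below it is not vertical, so it gives an
  affine minorant of \<open>f\<close>. The quadratic term dominates this minorant, hence sublevel sets of the
  objective inside the closed epigraph are compact.
\<close>

lemma prox_objective_attains_min:
  fixes f :: "'a::euclidean_space \<Rightarrow> ereal"
  assumes f: "closed_proper_convex_on UNIV f"
  shows "\<exists>p. is_arg_min (\<lambda>w. f w + ereal (1 / 2 * (norm (w - v))\<^sup>2)) (\<lambda>_. True) p"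
proof -
  define E where "E = ereal_epigraph UNIV f"
  have E: "convex E" "closed E" and ninf: "\<And>w. f w \<noteq> -\<infinity>"
    using f by (auto simp: E_def closed_proper_convex_on_def)
  have E_iff: "(w, r) \<in> E \<longleftrightarrow> f w \<le> ereal r" for w r
    by (simp add: E_def ereal_epigraph_def)
  obtain w0 r0 where w0: "f w0 = ereal r0"
    using closed_proper_convex_finite_point[OF f] .
  have "(w0, r0 - 1) \<notin> E"
    by (simp add: E_iff w0)
  from separating_hyperplane_closed_point[OF E this]
  obtain n b where nb: "n \<bullet> (w0, r0 - 1) < b" "\<forall>q\<in>E. b < n \<bullet> q"
    by blast
  obtain a \<alpha> where "n = (a, \<alpha>)"
    by fastforce
  with nb have ab: "a \<bullet> w0 + \<alpha> * (r0 - 1) < b" "\<And>w r. (w, r) \<in> E \<Longrightarrow> b < a \<bullet> w + \<alpha> * r"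
    by (force simp: inner_prod_def)+
  have "b < a \<bullet> w0 + \<alpha> * r0"
    by (rule ab(2)) (simp add: E_iff w0)
  with ab(1) have "\<alpha> > 0"
    by (simp add: algebra_simps)
  define \<phi> where "\<phi> = (\<lambda>q::'a \<times> real. snd q + 1 / 2 * (norm (fst q - v))\<^sup>2)"
  have minorant: "b / \<alpha> - (a /\<^sub>R \<alpha>) \<bullet> w < r" if "(w, r) \<in> E" for w r
    using ab(2)[OF that] \<open>\<alpha> > 0\<close> by (simp add: field_simps)
  define K where "K = {q \<in> E. \<phi> q \<le> \<phi> (w0, r0)}"
  have "closed K"
  proof -
    have "K = E \<inter> {q. \<phi> q \<le> \<phi> (w0, r0)}"
      by (auto simp: K_def)
    moreover have "closed {q. \<phi> q \<le> \<phi> (w0, r0)}"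
      unfolding \<phi>_def by (intro closed_Collect_le continuous_intros)
    ultimately show ?thesis
      using E(2) by auto
  qed
  moreover have "bounded K"
  proof -
    define g where "g = a /\<^sub>R \<alpha>"
    define R where "R = \<phi> (w0, r0) - b / \<alpha> + g \<bullet> v + (norm g)\<^sup>2"
    define N where "N = norm v + (1 + 4 * \<bar>R\<bar>)"
    define M where "M = \<bar>\<phi> (w0, r0)\<bar> + \<bar>b / \<alpha>\<bar> + norm g * N"
    have "norm w \<le> N \<and> \<bar>r\<bar> \<le> M" if "(w, r) \<in> K" for w r
    proof -
      have *: "b / \<alpha> - g \<bullet> w < r" "r + 1 / 2 * (norm (w - v))\<^sup>2 \<le> \<phi> (w0, r0)"
        using that minorant by (auto simp: K_def g_def \<phi>_def)
      have "g \<bullet> w \<le> g \<bullet> v + norm g * norm (w - v)"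
        using Cauchy_Schwarz_ineq2[of g "w - v"] by (simp add: inner_diff_right)
      \<comment> \<open>Half of the quadratic term absorbs the slope of the minorant; the rest bounds \<open>w - v\<close>.\<close>
      moreover have "norm g * norm (w - v) \<le> (norm g)\<^sup>2 + 1/4 * (norm (w - v))\<^sup>2"
      proof -
        have "0 \<le> (norm g - norm (w - v) / 2)\<^sup>2"
          by simp
        also have "\<dots> = (norm g)\<^sup>2 + 1/4 * (norm (w - v))\<^sup>2 - norm g * norm (w - v)"
          by (simp add: power2_eq_square field_simps)
        finally show ?thesis by simp
      qed
      ultimately have "(norm (w - v))\<^sup>2 \<le> 4 * R"
        using * unfolding R_def by argo
      then have "(norm (w - v))\<^sup>2 \<le> 4 * \<bar>R\<bar>"
        by linarith
      moreover have "norm (w - v) \<le> 1 + (norm (w - v))\<^sup>2"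
      proof -
        have "0 \<le> (norm (w - v) - 1 / 2)\<^sup>2"
          by simp
        also have "\<dots> = (norm (w - v))\<^sup>2 - norm (w - v) + 1 / 4"
          by (simp add: power2_eq_square field_simps)
        finally show ?thesis by simp
      qed
      ultimately have w: "norm w \<le> N"
        using norm_triangle_ineq[of "w - v" v] by (simp add: N_def)
      have "\<bar>g \<bullet> w\<bar> \<le> norm g * N"
        using Cauchy_Schwarz_ineq2[of g w] mult_left_mono[OF w norm_ge_zero[of g]] by linarith
      with * have "\<bar>r\<bar> \<le> M"
        unfolding M_def using zero_le_power2[of "norm (w - v)"] by linarith
      with w show ?thesis by simp
    qed
    then have "K \<subseteq> cball 0 N \<times> cball 0 M"
      by auto
    then show ?thesis
      by (rule bounded_subset[rotated]) (intro bounded_Times bounded_cball)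
  qed
  ultimately have "compact K"
    by (simp add: compact_eq_bounded_closed)
  moreover have "(w0, r0) \<in> K"
    by (simp add: K_def E_iff w0)
  moreover have "continuous_on K \<phi>"
    unfolding \<phi>_def by (intro continuous_intros)
  ultimately obtain p where p: "p \<in> K" "\<And>q. q \<in> K \<Longrightarrow> \<phi> p \<le> \<phi> q"
    using continuous_attains_inf[of K \<phi>] by blast
  have minE: "\<phi> p \<le> \<phi> q" if "q \<in> E" for q
    using p(2)[of q] p(2)[OF \<open>(w0, r0) \<in> K\<close>] that by (force simp: K_def)
  have "f (fst p) + ereal (1 / 2 * (norm (fst p - v))\<^sup>2) \<le> f w + ereal (1 / 2 * (norm (w - v))\<^sup>2)" for w
  proof (cases "f w")
    case (real r)
    have "f (fst p) \<le> ereal (snd p)"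
      using p(1) E_iff[of "fst p" "snd p"] by (simp add: K_def)
    then have "f (fst p) + ereal (1 / 2 * (norm (fst p - v))\<^sup>2) \<le> ereal (\<phi> p)"
      unfolding \<phi>_def by (metis add_right_mono plus_ereal.simps(1))
    also have "\<dots> \<le> ereal (\<phi> (w, r))"
      using minE[of "(w, r)"] real by (simp add: E_iff)
    also have "\<dots> = f w + ereal (1 / 2 * (norm (w - v))\<^sup>2)"
      by (simp add: \<phi>_def real)
    finally show ?thesis .
  qed (use ninf in auto)
  then show ?thesis
    unfolding is_arg_min_def by (metis not_le)
qed

lemma Prox_subgradient:
  fixes f :: "'a::euclidean_space \<Rightarrow> ereal"
  assumes f: "closed_proper_convex_on UNIV f"
  shows "v - Prox f v \<in> subdifferential f (Prox f v)"
proof -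
  have "is_arg_min (\<lambda>w. f w + ereal (1 / 2 * (norm (w - v))\<^sup>2)) (\<lambda>_. True) (Prox f v)"
    unfolding Prox_def arg_min_def using prox_objective_attains_min[OF f] by (rule someI_ex)
  moreover have "1 / 2 * (norm (p + t *\<^sub>R d - v))\<^sup>2
      = 1 / 2 * (norm (p - v))\<^sup>2 + t * ((p - v) \<bullet> d) + t\<^sup>2 * (1 / 2 * (d \<bullet> d))" for p d t
  proof -
    have "p + t *\<^sub>R d - v = (p - v) + t *\<^sub>R d"
      by simp
    then show ?thesis
      unfolding power2_norm_eq_inner
      by (simp only: inner_add_left inner_add_right inner_scaleR_left inner_scaleR_right
          inner_commute[of d "p - v"]) (simp add: power2_eq_square field_simps)
  qed
  ultimately have "- (Prox f v - v) \<in> subdifferential f (Prox f v)"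
    by (rule subgradient_of_minimizer[OF f, where H = "\<lambda>d. 1 / 2 * (d \<bullet> d)"])
  then show ?thesis
    by simp
qed

text \<open>
  This is how the residual of the optimality system is estimated: any subgradient \<open>\<xi>\<close> at \<open>y\<close>
  satisfies \<open>y = Prox f (y + \<xi>)\<close>, and \<open>Prox\<close> is nonexpansive. Taking \<open>\<eta> = \<xi>\<close> also gives
  uniqueness of the proximal point.
\<close>

lemma norm_diff_Prox_le:
  assumes f: "closed_proper_convex_on UNIV f" and \<xi>: "\<xi> \<in> subdifferential f y"
  shows "norm (y - Prox f (y + \<eta>)) \<le> norm (\<xi> - \<eta>)"
proof -
  define p where "p = Prox f (y + \<eta>)"
  have "0 \<le> (\<xi> - (y + \<eta> - p)) \<bullet> (y - p)"
    using subdifferential_monotone[OF f \<xi> Prox_subgradient[OF f]] by (simp add: p_def)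
  then have "norm (y - p) * norm (y - p) \<le> (\<xi> - \<eta>) \<bullet> (y - p)"
    unfolding power2_eq_square[symmetric] power2_norm_eq_inner
    by (simp add: inner_diff_left inner_diff_right inner_add_left inner_add_right)
  also have "\<dots> \<le> norm (\<xi> - \<eta>) * norm (y - p)"
    by (rule norm_cauchy_schwarz)
  finally show ?thesis
    unfolding p_def[symmetric] by (metis mult_right_le_imp_le norm_ge_zero order_le_less)
qed

lemma Prox_fixed_point_iff:
  assumes f: "closed_proper_convex_on UNIV f"
  shows "y = Prox f (y + \<eta>) \<longleftrightarrow> \<eta> \<in> subdifferential f y"
proof
  assume "y = Prox f (y + \<eta>)"
  then show "\<eta> \<in> subdifferential f y"
    using Prox_subgradient[OF f, of "y + \<eta>"] by (metis add_diff_cancel_left')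
next
  assume "\<eta> \<in> subdifferential f y"
  from norm_diff_Prox_le[OF f this, of \<eta>] show "y = Prox f (y + \<eta>)"
    by simp
qed

lemma KKT_map_zeros:
  assumes "closed_proper_convex_on UNIV f" and "closed_proper_convex_on UNIV g"
  shows "{u. KKT_map f g A B c u = 0} = KKT_points f g A B c"
proof -
  have "KKT_map f g A B c (y, z, x) = 0 \<longleftrightarrow> (y, z, x) \<in> KKT_points f g A B c" for y z x
    using Prox_fixed_point_iff[OF assms(1), of y "A x"] Prox_fixed_point_iff[OF assms(2), of z "B x"]
    by (simp add: KKT_map_def KKT_points_def zero_prod_def)
  then show ?thesis
    by auto
qed

section \<open>Positive semidefinite operators, the metric and the one-step estimate\<close>

lemma norm_square_add_scaleR:
  fixes a b :: "'a::real_inner"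
  shows "(norm (a + t *\<^sub>R b))\<^sup>2 = (norm a)\<^sup>2 + 2 * t * (a \<bullet> b) + t\<^sup>2 * (norm b)\<^sup>2"
  unfolding power2_norm_eq_inner inner_add_left inner_add_right
  by (simp add: inner_commute[of b a] power2_eq_square distrib_left)

lemma psd_operator_symmetric:
  assumes "psd_operator G"
  shows "G v \<bullet> w = v \<bullet> G w"
  using assms adjoint_works[of G v w] unfolding psd_operator_def by simp

lemma psd_operator_polarization:
  assumes G: "psd_operator G"
  shows "2 * (G (v - w) \<bullet> v) = v \<bullet> G v - w \<bullet> G w + (v - w) \<bullet> G (v - w)"
proof -
  have "linear G"
    using G by (simp add: psd_operator_def)
  then show ?thesis
    using psd_operator_symmetric[OF G, of v w] psd_operator_symmetric[OF G, of w v]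
      psd_operator_symmetric[OF G, of v v]
    by (simp only: linear_diff inner_diff_left inner_diff_right) (simp add: inner_commute[of "G w" v])
qed

lemma psd_operator_young:
  assumes G: "psd_operator G"
  shows "2 * (v \<bullet> G w) \<le> v \<bullet> G v + w \<bullet> G w"
proof -
  have "0 \<le> (v - w) \<bullet> G (v - w)" and "linear G"
    using G by (auto simp: psd_operator_def)
  moreover have "G (v - w) \<bullet> v = v \<bullet> G v - v \<bullet> G w"
    using \<open>linear G\<close> by (simp add: linear_diff inner_diff_left inner_commute[of "G v" v] inner_commute[of "G w" v])
  ultimately show ?thesis
    using psd_operator_polarization[OF G, of v w] by linarith
qed

lemma op_norm_wrt_square:
  assumes "psd_operator G"
  shows "(op_norm_wrt G v)\<^sup>2 = v \<bullet> G v"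
  using assms by (simp add: op_norm_wrt_def psd_operator_def)

text \<open>
  The semi-norm of \<open>G\<close> controls \<open>G v\<close>, although it does not control \<open>v\<close>: test positivity at
  \<open>v - (1 / K) *\<^sub>R G v\<close>, where \<open>K\<close> bounds the operator norm.
\<close>

lemma psd_operator_norm_square_le:
  assumes G: "psd_operator G"
  obtains K where "K > 0" "\<And>v. (norm (G v))\<^sup>2 \<le> K * (v \<bullet> G v)"
proof -
  have lin: "linear G" and nonneg: "\<And>v. 0 \<le> v \<bullet> G v"
    using G by (auto simp: psd_operator_def)
  obtain K where K: "K > 0" "\<And>v. norm (G v) \<le> K * norm v"
    using linear_bounded_pos[OF lin] by blast
  have "(norm (G v))\<^sup>2 \<le> K * (v \<bullet> G v)" for v
  proof -
    have "G v \<bullet> G (G v) \<le> norm (G v) * (K * norm (G v))"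
      using norm_cauchy_schwarz[of "G v" "G (G v)"] mult_left_mono[OF K(2)[of "G v"] norm_ge_zero[of "G v"]]
      by linarith
    then have "(1 / K)\<^sup>2 * (G v \<bullet> G (G v)) \<le> (1 / K)\<^sup>2 * (K * (norm (G v))\<^sup>2)"
      by (intro mult_left_mono) (auto simp: power2_eq_square mult_ac)
    also have "\<dots> = (norm (G v))\<^sup>2 / K"
      using K(1) by (simp add: power2_eq_square field_simps)
    finally have "(1 / K)\<^sup>2 * (G v \<bullet> G (G v)) \<le> (norm (G v))\<^sup>2 / K" .
    moreover have "0 \<le> (v - (1 / K) *\<^sub>R G v) \<bullet> G (v - (1 / K) *\<^sub>R G v)"
      by (rule nonneg)
    moreover have "\<dots> = v \<bullet> G v - 2 * ((norm (G v))\<^sup>2 / K) + (1 / K)\<^sup>2 * (G v \<bullet> G (G v))"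
    proof -
      have "v \<bullet> G (G v) = G v \<bullet> G v"
        by (rule psd_operator_symmetric[OF G, symmetric])
      then show ?thesis
        unfolding linear_diff[OF lin] linear_scale[OF lin] power2_norm_eq_inner
          inner_diff_left inner_diff_right inner_scaleR_left inner_scaleR_right
        by (simp add: power2_eq_square diff_divide_distrib)
    qed
    ultimately have "(norm (G v))\<^sup>2 / K \<le> v \<bullet> G v"
      by linarith
    then show ?thesis
      using K(1) by (simp add: field_simps)
  qed
  with K(1) show ?thesis
    by (rule that)
qed

text \<open>
  The lower bound makes the term \<open>o_const \<rho>\<close> in the metric nonnegative; the upper bound lets
  half of the decrease won by an iteration pay for that term at the next iterate.
\<close>

lemma o_const_bounds:
  assumes "0 < \<rho>" "\<rho> < 2"
  shows "0 \<le> o_const \<rho>" "o_const \<rho> \<le> 2 * (2 - \<rho>)"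
proof -
  have "0 \<le> \<rho> * l_const \<rho> \<and> \<rho> * l_const \<rho> \<le> 2"
  proof (cases "\<rho> \<le> (1 + sqrt 5) / 2")
    case True
    then show ?thesis
      using assms by (simp add: l_const_def)
  next
    case False
    have "sqrt 5 \<ge> 2"
      by (rule real_le_rsqrt) simp
    with False have "\<rho> > 3 / 2"
      by simp
    then have "(3 / 2) * (3 / 2) \<le> \<rho> * \<rho>"
      by (intro mult_mono) auto
    then have "\<rho> * (2 - \<rho>) \<le> 2 * (\<rho> - 1)"
      by (simp add: algebra_simps)
    with \<open>\<rho> > 3 / 2\<close> assms False show ?thesis
      by (auto simp: l_const_def divide_simps)
  qed
  then show "0 \<le> o_const \<rho>" "o_const \<rho> \<le> 2 * (2 - \<rho>)"
    using assms unfolding o_const_def mult.commute[of 2 "2 - \<rho>"]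
    by (intro mult_nonneg_nonneg mult_left_mono; linarith)+
qed

lemma linear_eps_adj:
  assumes "linear A" and "linear B"
  shows "linear (eps_adj A B)"
  using adjoint_linear[OF assms(1)] adjoint_linear[OF assms(2)]
  by (intro linearI) (auto simp: eps_adj_def linear_add linear_scale algebra_simps)

lemma linear_M_op:
  assumes "linear A" "linear B" "linear S" "linear T" "linear Sf" "linear Sg"
  shows "linear (M_op A B S T Sf Sg \<rho> \<sigma>)"
proof -
  have lin: "linear (eps A B)" "linear (adjoint A)" "linear (adjoint B)"
    unfolding eps_def using assms by (auto intro: adjoint_linear linear_eps_adj)
  let ?D = "\<lambda>(y, z, x). (S y + Sf y, M_rho_op B T Sg \<rho> \<sigma> (z, x))"
  have "linear ?D"
    using assms lin(3)
    by (intro linearI) (auto simp: M_rho_op_def linear_add linear_scale algebra_simps)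
  moreover have "linear (\<lambda>u. (1 / 4 * o_const \<rho> * \<sigma>) *\<^sub>R eps A B (eps_adj A B u))"
    using linear_compose[OF linear_eps_adj[OF assms(1,2)] lin(1)]
    by (intro linear_compose_scale_right) (simp add: o_def)
  ultimately have "linear (\<lambda>u. ?D u + (1 / 4 * o_const \<rho> * \<sigma>) *\<^sub>R eps A B (eps_adj A B u))"
    by (rule linear_compose_add)
  also have "(\<lambda>u. ?D u + (1 / 4 * o_const \<rho> * \<sigma>) *\<^sub>R eps A B (eps_adj A B u)) = M_op A B S T Sf Sg \<rho> \<sigma>"
    by (auto simp: M_op_def)
  finally show ?thesis .
qed

text \<open>
  Completing the square exhibits \<open>x + \<sigma> *\<^sub>R adjoint B z\<close>, the governing variable of the
  Douglas-Rachford iteration that underlies the method.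
\<close>

lemma inner_M_op:
  assumes lin: "linear A" "linear B" and "\<rho> > 0" "\<sigma> > 0"
  shows "(y, z, x) \<bullet> M_op A B S T Sf Sg \<rho> \<sigma> (y, z, x) =
    y \<bullet> S y + y \<bullet> Sf y + z \<bullet> T z + z \<bullet> Sg z
      + (norm (x + \<sigma> *\<^sub>R adjoint B z))\<^sup>2 / (\<sigma> * \<rho>) - 2 * (x \<bullet> adjoint B z)
      + o_const \<rho> * \<sigma> / 4 * (norm (adjoint A y + adjoint B z))\<^sup>2"
proof -
  have eps: "(y, z, x) \<bullet> eps A B p = eps_adj A B (y, z, x) \<bullet> p" for p
    unfolding eps_def by (rule adjoint_works[OF linear_eps_adj[OF lin]])
  have B: "z \<bullet> B p = adjoint B z \<bullet> p" for p
    using adjoint_works[OF lin(2), of p z] by (simp add: inner_commute)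
  have "(y, z, x) \<bullet> M_op A B S T Sf Sg \<rho> \<sigma> (y, z, x) =
    y \<bullet> S y + y \<bullet> Sf y + z \<bullet> T z + z \<bullet> Sg z
      + (\<sigma> / \<rho> * (adjoint B z \<bullet> adjoint B z) + 2 * ((1 - \<rho>) / \<rho>) * (x \<bullet> adjoint B z)
      + 1 / (\<sigma> * \<rho>) * (x \<bullet> x)) + o_const \<rho> * \<sigma> / 4 * (norm (adjoint A y + adjoint B z))\<^sup>2"
    unfolding M_op_def M_rho_op_def prod.case inner_add_right[of "(y, z, x)"] inner_scaleR_right eps
    by (simp add: inner_add_right B eps_adj_def power2_norm_eq_inner inner_commute)
  also have "\<sigma> / \<rho> * (adjoint B z \<bullet> adjoint B z) + 2 * ((1 - \<rho>) / \<rho>) * (x \<bullet> adjoint B z)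
      + 1 / (\<sigma> * \<rho>) * (x \<bullet> x)
      = (norm (x + \<sigma> *\<^sub>R adjoint B z))\<^sup>2 / (\<sigma> * \<rho>) - 2 * (x \<bullet> adjoint B z)"
    using \<open>\<rho> > 0\<close> \<open>\<sigma> > 0\<close> unfolding power2_norm_eq_inner
    by (simp add: inner_add inner_commute field_simps)
  finally show ?thesis
    by simp
qed

lemma inner_M_op_nonneg:
  assumes "linear A" "linear B" "0 < \<rho>" "\<rho> < 2" "0 < \<sigma>"
    and "psd_operator S" "psd_operator T" "psd_operator Sf" "psd_operator Sg"
  shows "0 \<le> u \<bullet> M_op A B S T Sf Sg \<rho> \<sigma> u"
proof -
  obtain y z x where u: "u = (y, z, x)"
    by (cases u) auto
  define b where "b = \<sigma> *\<^sub>R adjoint B z"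
  have "2 * \<rho> * (x \<bullet> b) \<le> (norm (x + b))\<^sup>2"
  proof -
    have "4 * (x \<bullet> b) \<le> (norm (x + b))\<^sup>2"
      using zero_le_power2[of "norm (x - b)"]
      unfolding power2_norm_eq_inner by (simp add: inner_diff inner_add inner_commute)
    moreover have "2 * \<rho> * (x \<bullet> b) \<le> 4 * (x \<bullet> b)" if "0 \<le> x \<bullet> b"
      using \<open>\<rho> < 2\<close> that by (intro mult_right_mono) auto
    moreover have "2 * \<rho> * (x \<bullet> b) \<le> 0" if "x \<bullet> b \<le> 0"
      using \<open>\<rho> > 0\<close> that by (intro mult_nonneg_nonpos) auto
    ultimately show ?thesis
      by (smt (verit) zero_le_power2)
  qed
  then have "2 * (x \<bullet> adjoint B z) \<le> (norm (x + \<sigma> *\<^sub>R adjoint B z))\<^sup>2 / (\<sigma> * \<rho>)"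
    using \<open>\<rho> > 0\<close> \<open>\<sigma> > 0\<close> by (simp add: b_def field_simps)
  moreover have "0 \<le> o_const \<rho> * \<sigma> / 4 * (norm (adjoint A y + adjoint B z))\<^sup>2"
    using o_const_bounds[OF \<open>0 < \<rho>\<close> \<open>\<rho> < 2\<close>] \<open>\<sigma> > 0\<close> by simp
  ultimately show ?thesis
    unfolding u inner_M_op[OF assms(1-3,5)] using assms(6-9)
    by (smt (verit) psd_operator_def)
qed

text \<open>
  The one-step estimate, in terms of the errors \<open>y\<close>, \<open>z\<close>, \<open>x\<close> before and \<open>y'\<close>, \<open>z'\<close>, \<open>x'\<close>
  after an iteration, with \<open>w\<close> the preceding increment of \<open>z\<close>. The variable
  \<open>v = x + \<sigma> *\<^sub>R adjoint B z\<close> moves by \<open>- \<sigma> * \<rho>\<close> times \<open>r\<close>; expanding the square and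
  using monotonicity of the two subdifferentials at the solution gives descent of the form without
  its \<open>o_const\<close> term, with gain \<open>(2 - \<rho>) * \<sigma> * (norm r)\<^sup>2\<close>. This does not yet control the
  \<open>o_const\<close> term, which involves \<open>r + \<beta>\<close>. Monotonicity of the subdifferential of \<open>g\<close> between the
  two consecutive \<open>z\<close>, taken with weight \<open>2 * (2 - \<rho>) / \<rho>\<close>, supplies exactly the cross term
  that completes \<open>(norm r)\<^sup>2\<close> to \<open>(norm (r + \<beta>))\<^sup>2\<close>, a surplus in \<open>\<beta>\<close>, and the telescoping
  \<open>T\<close>-terms.
\<close>

lemma inner_M_op_descent:
  assumes lin: "linear A" "linear B" and pos: "0 < \<rho>" "\<rho> < 2" "0 < \<sigma>"
    and psd: "psd_operator S" "psd_operator T" "psd_operator Sf" "psd_operator Sg"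
    and r: "r = adjoint A y' + adjoint B z" and \<beta>: "\<beta> = adjoint B (z' - z)"
    and x': "x' = x - \<sigma> *\<^sub>R (\<rho> *\<^sub>R r + \<beta>)"
    and mono_f: "y' \<bullet> Sf y' \<le> (A (x - \<sigma> *\<^sub>R r) - S (y' - y)) \<bullet> y'"
    and mono_g: "z' \<bullet> Sg z' \<le> (B x' - T (z' - z)) \<bullet> z'"
    and mono_g_step: "0 \<le> ((B x' - T (z' - z)) - (B x - T w)) \<bullet> (z' - z)"
  shows "(y', z', x') \<bullet> M_op A B S T Sf Sg \<rho> \<sigma> (y', z', x')
      + (2 - \<rho>) / \<rho> * ((z' - z) \<bullet> T (z' - z))
      + ((2 - \<rho>) * \<sigma> / 2 * (norm (r + \<beta>))\<^sup>2 + (2 - \<rho>)\<^sup>2 / \<rho> * \<sigma> * (norm \<beta>)\<^sup>2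
        + (y' - y) \<bullet> S (y' - y) + (z' - z) \<bullet> T (z' - z))
    \<le> (y, z, x) \<bullet> M_op A B S T Sf Sg \<rho> \<sigma> (y, z, x) + (2 - \<rho>) / \<rho> * (w \<bullet> T w)"
proof -
  define a b where "a = adjoint A y'" and "b = adjoint B z"
  define \<tau> \<pi> where "\<tau> = (2 - \<rho>) / \<rho>" and "\<pi> = (2 - \<rho>) * \<sigma>"
  have adj: "A p \<bullet> v = p \<bullet> adjoint A v" "B p \<bullet> w = p \<bullet> adjoint B w" for p v w
    by (simp_all add: adjoint_works lin)
  have b': "adjoint B z' = b + \<beta>"
    by (simp add: b_def \<beta> linear_diff[OF adjoint_linear[OF lin(2)]])
  have r': "r = a + b"
    by (simp add: r a_def b_def)
  \<comment> \<open>The error of the Douglas-Rachford variable after the step.\<close>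
  have DR: "(norm (x' + \<sigma> *\<^sub>R (b + \<beta>)))\<^sup>2 / (\<sigma> * \<rho>) = (norm (x + \<sigma> *\<^sub>R b))\<^sup>2 / (\<sigma> * \<rho>)
      - 2 * ((x - \<sigma> *\<^sub>R r) \<bullet> a) - 2 * (x \<bullet> b) - \<pi> * (norm r)\<^sup>2"
  proof -
    have "x' + \<sigma> *\<^sub>R (b + \<beta>) = (x + \<sigma> *\<^sub>R b) - (\<sigma> * \<rho>) *\<^sub>R r"
      by (simp add: x' algebra_simps)
    then have "(norm (x' + \<sigma> *\<^sub>R (b + \<beta>)))\<^sup>2 = (norm (x + \<sigma> *\<^sub>R b))\<^sup>2
        - \<sigma> * \<rho> * (2 * ((x + \<sigma> *\<^sub>R b) \<bullet> r)) + \<sigma> * \<rho> * (\<sigma> * \<rho> * (norm r)\<^sup>2)"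
      using norm_square_add_scaleR[of "x + \<sigma> *\<^sub>R b" "- (\<sigma> * \<rho>)" r]
      by (simp add: power2_eq_square)
    moreover have "(x + \<sigma> *\<^sub>R b) \<bullet> r = (x - \<sigma> *\<^sub>R r) \<bullet> a + x \<bullet> b + \<sigma> * (norm r)\<^sup>2"
      unfolding r' power2_norm_eq_inner
      by (simp add: inner_diff inner_add inner_commute algebra_simps)
    ultimately show ?thesis
      using pos by (simp add: \<pi>_def field_simps)
  qed
  have f: "y' \<bullet> Sf y' \<le> (x - \<sigma> *\<^sub>R r) \<bullet> a - S (y' - y) \<bullet> y'"
    using mono_f by (simp add: inner_diff_left adj a_def)
  have g: "z' \<bullet> Sg z' \<le> x' \<bullet> (b + \<beta>) - T (z' - z) \<bullet> z'"
    using mono_g by (simp add: inner_diff_left adj b')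
  \<comment> \<open>Monotonicity between consecutive \<open>z\<close>, still unweighted.\<close>
  have "0 \<le> - \<sigma> * \<rho> * (r \<bullet> \<beta>) - \<sigma> * (norm \<beta>)\<^sup>2 - (z' - z) \<bullet> T (z' - z) + (z' - z) \<bullet> T w"
  proof -
    have "((B x' - T (z' - z)) - (B x - T w)) \<bullet> (z' - z)
        = (x' - x) \<bullet> \<beta> - (z' - z) \<bullet> T (z' - z) + (z' - z) \<bullet> T w"
      unfolding inner_diff_left[of _ _ "z' - z"] adj \<beta>[symmetric] inner_diff_left[of x' x \<beta>]
      by (simp only: inner_commute[of "T (z' - z)" "z' - z"] inner_commute[of "T w" "z' - z"])
    also have "(x' - x) \<bullet> \<beta> = - \<sigma> * \<rho> * (r \<bullet> \<beta>) - \<sigma> * (norm \<beta>)\<^sup>2"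
      unfolding x' power2_norm_eq_inner by (simp add: inner_add_left right_diff_distrib algebra_simps)
    finally show ?thesis
      using mono_g_step by simp
  qed
  moreover have "2 * ((z' - z) \<bullet> T w) \<le> (z' - z) \<bullet> T (z' - z) + w \<bullet> T w"
    by (rule psd_operator_young[OF psd(2)])
  ultimately have "0 \<le> - 2 * (\<sigma> * \<rho> * (r \<bullet> \<beta>)) - 2 * (\<sigma> * (norm \<beta>)\<^sup>2) - (z' - z) \<bullet> T (z' - z) + w \<bullet> T w"
    by linarith
  moreover have "\<tau> \<ge> 0"
    using pos by (simp add: \<tau>_def)
  ultimately have "0 \<le> \<tau> * (- 2 * (\<sigma> * \<rho> * (r \<bullet> \<beta>)) - 2 * (\<sigma> * (norm \<beta>)\<^sup>2) - (z' - z) \<bullet> T (z' - z) + w \<bullet> T w)"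
    by (simp add: mult_nonneg_nonneg)
  also have "\<dots> = - 2 * ((\<tau> * \<rho>) * \<sigma> * (r \<bullet> \<beta>)) - 2 * \<tau> * (\<sigma> * (norm \<beta>)\<^sup>2)
      - \<tau> * ((z' - z) \<bullet> T (z' - z)) + \<tau> * (w \<bullet> T w)"
    by (simp add: algebra_simps)
  also have "\<tau> * \<rho> * \<sigma> = \<pi>"
    using pos by (simp add: \<tau>_def \<pi>_def)
  finally have step: "0 \<le> - 2 * (\<pi> * (r \<bullet> \<beta>)) - 2 * \<tau> * (\<sigma> * (norm \<beta>)\<^sup>2)
      - \<tau> * ((z' - z) \<bullet> T (z' - z)) + \<tau> * (w \<bullet> T w)" .
  \<comment> \<open>Half of the gain in \<open>r + \<beta>\<close> pays for the \<open>o_const\<close> term of the next iterate.\<close>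
  have "o_const \<rho> * \<sigma> / 4 \<le> \<pi> / 2"
    using mult_right_mono[OF o_const_bounds(2)[OF pos(1,2)], of \<sigma>] pos by (simp add: \<pi>_def)
  then have "o_const \<rho> * \<sigma> / 4 * (norm (r + \<beta>))\<^sup>2 \<le> \<pi> / 2 * (norm (r + \<beta>))\<^sup>2"
    by (rule mult_right_mono) simp
  moreover have "(2 - \<rho>)\<^sup>2 / \<rho> * \<sigma> = 2 * (\<tau> * \<sigma>) - \<pi>"
    using pos by (simp add: \<tau>_def \<pi>_def power2_eq_square field_simps)
  then have "(2 - \<rho>)\<^sup>2 / \<rho> * \<sigma> * (norm \<beta>)\<^sup>2 = 2 * \<tau> * (\<sigma> * (norm \<beta>)\<^sup>2) - \<pi> * (norm \<beta>)\<^sup>2"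
    by (simp only: left_diff_distrib mult.assoc)
  moreover have "\<pi> * (norm (r + \<beta>))\<^sup>2 = \<pi> * (norm r)\<^sup>2 + 2 * (\<pi> * (r \<bullet> \<beta>)) + \<pi> * (norm \<beta>)\<^sup>2"
    using norm_square_add_scaleR[of r 1 \<beta>] by (simp add: distrib_left)
  ultimately have tail: "\<tau> * ((z' - z) \<bullet> T (z' - z)) + \<pi> / 2 * (norm (r + \<beta>))\<^sup>2
      + (2 - \<rho>)\<^sup>2 / \<rho> * \<sigma> * (norm \<beta>)\<^sup>2 + o_const \<rho> * \<sigma> / 4 * (norm (r + \<beta>))\<^sup>2
      \<le> \<pi> * (norm r)\<^sup>2 + \<tau> * (w \<bullet> T w)"
    using step by linarith
  have "y' \<bullet> S y' + z' \<bullet> T z' + (norm (x' + \<sigma> *\<^sub>R (b + \<beta>)))\<^sup>2 / (\<sigma> * \<rho>) - 2 * (x' \<bullet> (b + \<beta>))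
      + 2 * (y' \<bullet> Sf y') + 2 * (z' \<bullet> Sg z')
      + (y' - y) \<bullet> S (y' - y) + (z' - z) \<bullet> T (z' - z) + \<pi> * (norm r)\<^sup>2
      \<le> y \<bullet> S y + z \<bullet> T z + (norm (x + \<sigma> *\<^sub>R b))\<^sup>2 / (\<sigma> * \<rho>) - 2 * (x \<bullet> b)"
    unfolding DR using f g psd_operator_polarization[OF psd(1), of y' y]
      psd_operator_polarization[OF psd(2), of z' z] by linarith
  moreover have "0 \<le> o_const \<rho> * \<sigma> / 4 * (norm (a' + b))\<^sup>2" for a'
    using o_const_bounds[OF pos(1,2)] pos by simp
  moreover have "0 \<le> y \<bullet> Sf y" "0 \<le> y' \<bullet> Sf y'" "0 \<le> z \<bullet> Sg z" "0 \<le> z' \<bullet> Sg z'"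
    using psd by (auto simp: psd_operator_def)
  moreover have "a + (b + \<beta>) = r + \<beta>"
    by (simp add: r')
  ultimately show ?thesis
    using tail
    unfolding inner_M_op[OF lin pos(1,3)] b' a_def[symmetric] b_def[symmetric] \<tau>_def[symmetric]
      \<pi>_def[symmetric] \<open>a + (b + \<beta>) = r + \<beta>\<close>
    by (smt (verit))
qed

lemma proximal_step_subgradient:
  fixes f :: "'y::euclidean_space \<Rightarrow> ereal" and L :: "'x::euclidean_space \<Rightarrow> 'y"
  assumes f: "closed_proper_convex_on UNIV f" and L: "linear L" and S: "psd_operator S"
    and min: "is_arg_min (\<lambda>w. f w + ereal (- inner a w + \<sigma> / 2 * (norm (adjoint L w + e))\<^sup>2
             + 1 / 2 * (op_norm_wrt S (w - w0))\<^sup>2)) (\<lambda>_. True) p"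
  shows "a - \<sigma> *\<^sub>R L (adjoint L p + e) - S (p - w0) \<in> subdifferential f p"
proof -
  have lin: "linear (adjoint L)" "linear S"
    using adjoint_linear[OF L] S by (auto simp: psd_operator_def)
  have "- inner a (p + t *\<^sub>R d) + \<sigma> / 2 * (norm (adjoint L (p + t *\<^sub>R d) + e))\<^sup>2
        + 1 / 2 * (op_norm_wrt S (p + t *\<^sub>R d - w0))\<^sup>2
      = (- inner a p + \<sigma> / 2 * (norm (adjoint L p + e))\<^sup>2 + 1 / 2 * (op_norm_wrt S (p - w0))\<^sup>2)
        + t * ((- (a - \<sigma> *\<^sub>R L (adjoint L p + e) - S (p - w0))) \<bullet> d)
        + t\<^sup>2 * (\<sigma> / 2 * (norm (adjoint L d))\<^sup>2 + 1 / 2 * (d \<bullet> S d))" for t d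
  proof -
    have 1: "adjoint L (p + t *\<^sub>R d) + e = (adjoint L p + e) + t *\<^sub>R adjoint L d"
      by (simp add: linear_add[OF lin(1)] linear_scale[OF lin(1)])
    have 2: "p + t *\<^sub>R d - w0 = (p - w0) + t *\<^sub>R d"
      by simp
    have 3: "(norm (adjoint L (p + t *\<^sub>R d) + e))\<^sup>2 = (norm (adjoint L p + e))\<^sup>2
        + 2 * t * (L (adjoint L p + e) \<bullet> d) + t\<^sup>2 * (norm (adjoint L d))\<^sup>2"
      unfolding 1 norm_square_add_scaleR by (simp add: adjoint_works[OF L])
    have 4: "(op_norm_wrt S (p + t *\<^sub>R d - w0))\<^sup>2 = (op_norm_wrt S (p - w0))\<^sup>2
        + 2 * t * (S (p - w0) \<bullet> d) + t\<^sup>2 * (d \<bullet> S d)"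
      unfolding op_norm_wrt_square[OF S] 2 linear_add[OF lin(2)] linear_scale[OF lin(2)]
      using psd_operator_symmetric[OF S, of "p - w0" d]
      by (simp only: inner_add_left inner_add_right inner_scaleR_left inner_scaleR_right
          inner_commute[of d "S (p - w0)"]) (simp add: power2_eq_square distrib_left)
    show ?thesis
      unfolding 3 4 by (simp only: inner_minus_left inner_diff_left inner_add_right[of a]
          inner_scaleR_left inner_scaleR_right) (simp add: field_simps)
  qed
  from subgradient_of_minimizer[OF f min this] show ?thesis
    by simp
qed

section \<open>Distances in a semi-norm and the contraction factor\<close>

lemma op_dist_wrt_nonneg_le:
  assumes G: "\<And>u. 0 \<le> u \<bullet> G u" and v: "v \<in> C"
  shows "0 \<le> op_dist_wrt G u C" "op_dist_wrt G u C \<le> op_norm_wrt G (u - v)"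
proof -
  have nonneg: "0 \<le> op_norm_wrt G w" for w
    by (simp add: op_norm_wrt_def G)
  show "0 \<le> op_dist_wrt G u C"
    unfolding op_dist_wrt_def using v by (intro cINF_greatest) (auto simp: nonneg)
  show "op_dist_wrt G u C \<le> op_norm_wrt G (u - v)"
    unfolding op_dist_wrt_def using v by (intro cINF_lower) (auto intro: bdd_belowI2[of _ 0] simp: nonneg)
qed

text \<open>
  This carries an inequality valid for every point of \<open>C\<close> over to the squared distance; \<open>s\<close> may be
  negative.
\<close>

lemma op_dist_wrt_square_greatest:
  assumes G: "\<And>u. 0 \<le> u \<bullet> G u" and "C \<noteq> {}"
    and s: "\<And>v. v \<in> C \<Longrightarrow> s \<le> (op_norm_wrt G (u - v))\<^sup>2"
  shows "s \<le> (op_dist_wrt G u C)\<^sup>2"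
proof (cases "s \<le> 0")
  case True
  then show ?thesis
    by (smt (verit) zero_le_power2)
next
  case False
  have "sqrt s \<le> op_dist_wrt G u C"
    unfolding op_dist_wrt_def
  proof (rule cINF_greatest[OF \<open>C \<noteq> {}\<close>])
    fix v assume "v \<in> C"
    then show "sqrt s \<le> op_norm_wrt G (u - v)"
      using real_sqrt_le_mono[OF s] G by (simp add: op_norm_wrt_def)
  qed
  then have "(sqrt s)\<^sup>2 \<le> (op_dist_wrt G u C)\<^sup>2"
    using False by (intro power_mono) auto
  then show ?thesis
    using False by simp
qed

lemma op_dist_wrt_square_le_infdist:
  fixes G :: "'a::euclidean_space \<Rightarrow> 'a"
  assumes G: "\<And>u. 0 \<le> u \<bullet> G u" and lin: "linear G"
  obtains K where "K > 0" "\<And>u C. C \<noteq> {} \<Longrightarrow> (op_dist_wrt G u C)\<^sup>2 \<le> K * (infdist u C)\<^sup>2"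
proof -
  obtain K where K: "K > 0" "\<And>w. norm (G w) \<le> K * norm w"
    using linear_bounded_pos[OF lin] by blast
  have norm_le: "op_norm_wrt G w \<le> sqrt K * norm w" for w
  proof -
    have "w \<bullet> G w \<le> norm w * (K * norm w)"
      using norm_cauchy_schwarz[of w "G w"] mult_left_mono[OF K(2)[of w] norm_ge_zero[of w]]
      by linarith
    then have "op_norm_wrt G w \<le> sqrt (K * (norm w)\<^sup>2)"
      unfolding op_norm_wrt_def by (intro real_sqrt_le_mono) (simp add: power2_eq_square mult_ac)
    then show ?thesis
      by (simp add: real_sqrt_mult)
  qed
  have "(op_dist_wrt G u C)\<^sup>2 \<le> K * (infdist u C)\<^sup>2" if C: "C \<noteq> {}" for u C
  proof -
    have "op_dist_wrt G u C / sqrt K \<le> infdist u C"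
      unfolding infdist_notempty[OF C]
    proof (rule cINF_greatest[OF C])
      fix v assume "v \<in> C"
      then show "op_dist_wrt G u C / sqrt K \<le> dist u v"
        using op_dist_wrt_nonneg_le(2)[OF G, of v C u] norm_le[of "u - v"] K(1)
        by (simp add: dist_norm field_simps)
    qed
    moreover have "0 \<le> op_dist_wrt G u C / sqrt K"
      using op_dist_wrt_nonneg_le(1)[OF G] C K(1) by (auto intro!: divide_nonneg_nonneg)
    ultimately have "(op_dist_wrt G u C / sqrt K)\<^sup>2 \<le> (infdist u C)\<^sup>2"
      by (intro power_mono)
    then show ?thesis
      using K(1) by (simp add: power_divide field_simps)
  qed
  with K(1) show ?thesis
    by (rule that)
qed

text \<open>
  The constant \<open>\<kappa>\<close> enters \<open>k5_hat\<close> only through \<open>\<kappa>\<^sup>2\<close> in a denominator, so enlarging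
  \<open>\<kappa>\<close> weakens the contraction factor towards 1.
\<close>

lemma theta_hat_tendsto_1:
  assumes "\<rho> \<noteq> 0"
  shows "((\<lambda>\<kappa>. theta_hat A B S T Sf Sg \<rho> \<sigma> \<kappa>) \<longlongrightarrow> 1) at_top"
proof -
  have "((\<lambda>\<kappa>::real. inverse (\<kappa>\<^sup>2)) \<longlongrightarrow> 0) at_top"
    by (intro tendsto_inverse_0_at_top filterlim_pow_at_top filterlim_ident) auto
  then have "((\<lambda>\<kappa>. k5_hat A B S T Sf Sg \<rho> \<sigma> \<kappa>) \<longlongrightarrow> min 1 (min (m_const \<rho>) (1 / 2 * n_const \<rho>))
      * inverse (k4_const A S T \<rho> \<sigma>) * \<rho> * inverse (2 - \<rho>) * 0
      * inverse (lambda_max (Mbar_op A B S T Sf Sg \<rho> \<sigma>))) at_top"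
    unfolding k5_hat_def by (intro tendsto_mult tendsto_const)
  then have k5: "((\<lambda>\<kappa>. k5_hat A B S T Sf Sg \<rho> \<sigma> \<kappa>) \<longlongrightarrow> 0) at_top"
    by simp
  have "((\<lambda>\<kappa>. theta_hat A B S T Sf Sg \<rho> \<sigma> \<kappa>)
      \<longlongrightarrow> inverse (1 + 0 * \<rho> * inverse (\<rho> + (2 - \<rho>) * 0))) at_top"
    unfolding theta_hat_def Let_def using assms by (intro tendsto_intros k5) auto
  then show ?thesis
    by simp
qed

section \<open>Optimality conditions and residual of the iterates\<close>

locale sPGADMM_run =
  fixes A :: "'x::euclidean_space \<Rightarrow> 'y::euclidean_space"
    and B :: "'x \<Rightarrow> 'z::euclidean_space"
    and c :: 'x
    and f :: "'y \<Rightarrow> ereal" and g :: "'z \<Rightarrow> ereal"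
    and Sf S :: "'y \<Rightarrow> 'y" and Sg T :: "'z \<Rightarrow> 'z"
    and \<rho> \<sigma> :: real
    and ys :: "nat \<Rightarrow> 'y" and zs :: "nat \<Rightarrow> 'z" and xs :: "nat \<Rightarrow> 'x"
  assumes lin_A: "linear A" and lin_B: "linear B"
    and f: "closed_proper_convex_on UNIV f" and g: "closed_proper_convex_on UNIV g"
    and psd_Sf: "psd_operator Sf" and psd_Sg: "psd_operator Sg"
    and psd_S: "psd_operator S" and psd_T: "psd_operator T"
    and mono_f: "monotone_modulus f Sf" and mono_g: "monotone_modulus g Sg"
    and \<rho>_pos: "0 < \<rho>" and \<rho>_less: "\<rho> < 2" and \<sigma>_pos: "0 < \<sigma>"
    and run: "sPGADMM f g A B c S T \<rho> \<sigma> ys zs xs"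
begin

abbreviation "\<Omega> \<equiv> KKT_points f g A B c"
abbreviation "Mbar \<equiv> Mbar_op A B S T Sf Sg \<rho> \<sigma>"
abbreviation "iterate k \<equiv> (ys k, zs k, xs k)"

text \<open>
  The constraint residual after the \<open>y\<close>-step, before \<open>z\<close> is updated.
\<close>

definition half_step_residual :: "nat \<Rightarrow> 'x" where
  "half_step_residual k = adjoint A (ys (Suc k)) + adjoint B (zs k) - c"

definition z_shift :: "nat \<Rightarrow> 'x" where
  "z_shift k = adjoint B (zs (Suc k) - zs k)"

text \<open>
  A measure of what one iteration changes: it bounds the squared optimality residual of the new iterate
  from above and the decrease of the Lyapunov function from below, up to constants.
\<close>

definition progress :: "nat \<Rightarrow> real" where
  "progress k = (norm (half_step_residual k + z_shift k))\<^sup>2 + (norm (z_shift k))\<^sup>2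
     + (op_norm_wrt S (ys (Suc k) - ys k))\<^sup>2 + (op_norm_wrt T (zs (Suc k) - zs k))\<^sup>2"

definition lyapunov :: "nat \<Rightarrow> real" where
  "lyapunov k = (op_dist_wrt Mbar (iterate k) \<Omega>)\<^sup>2 + (op_norm_wrt T (zs k - zs (k - 1)))\<^sup>2"

lemma multiplier_step:
  "xs (Suc k) = xs k - \<sigma> *\<^sub>R (\<rho> *\<^sub>R half_step_residual k + z_shift k)"
  using run by (simp add: sPGADMM_def half_step_residual_def z_shift_def)

lemma y_step_subgradient:
  "A (xs k - \<sigma> *\<^sub>R half_step_residual k) - S (ys (Suc k) - ys k) \<in> subdifferential f (ys (Suc k))"
proof -
  have "is_arg_min (\<lambda>y. f y + ereal (- inner (A (xs k)) y
      + \<sigma> / 2 * (norm (adjoint A y + (adjoint B (zs k) - c)))\<^sup>2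
      + 1 / 2 * (op_norm_wrt S (y - ys k))\<^sup>2)) (\<lambda>_. True) (ys (Suc k))"
    using run by (simp add: sPGADMM_def add_diff_eq)
  from proximal_step_subgradient[OF f lin_A psd_S this] show ?thesis
    by (simp add: half_step_residual_def linear_diff[OF lin_A] linear_scale[OF lin_A] add_diff_eq)
qed

text \<open>
  The multiplier update absorbs the gradient of the penalty term, so the new multiplier appears
  directly; the \<open>y\<close>-step, which precedes that update, involves the old multiplier and the half-step
  residual instead.
\<close>

lemma z_step_subgradient:
  "B (xs (Suc k)) - T (zs (Suc k) - zs k) \<in> subdifferential g (zs (Suc k))"
proof -
  have eq: "\<rho> *\<^sub>R half_step_residual k + adjoint B (z - zs k)
      = adjoint B z + (\<rho> *\<^sub>R half_step_residual k - adjoint B (zs k))" for z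
    by (simp add: linear_diff[OF adjoint_linear[OF lin_B]])
  have "is_arg_min (\<lambda>z. g z + ereal (- inner (B (xs k)) z
      + \<sigma> / 2 * (norm (\<rho> *\<^sub>R half_step_residual k + adjoint B (z - zs k)))\<^sup>2
      + 1 / 2 * (op_norm_wrt T (z - zs k))\<^sup>2)) (\<lambda>_. True) (zs (Suc k))"
    using run by (simp add: sPGADMM_def half_step_residual_def)
  from proximal_step_subgradient[OF g lin_B psd_T this[unfolded eq]] show ?thesis
    unfolding eq[symmetric] multiplier_step z_shift_def
    by (simp add: linear_diff[OF lin_B] linear_scale[OF lin_B])
qed

lemma primal_residual:
  "adjoint A (ys (Suc k)) + adjoint B (zs (Suc k)) - c = half_step_residual k + z_shift k"
  by (simp add: half_step_residual_def z_shift_def linear_diff[OF adjoint_linear[OF lin_B]])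

text \<open>
  By \<open>norm_diff_Prox_le\<close> each proximal component of the residual is at most the distance between the
  multiplier image and the subgradient produced by the subproblem. These distances consist of
  \<open>S\<close>- and \<open>T\<close>-images of increments and of multiples of the primal residual and of the shift in \<open>z\<close>.
\<close>

lemma KKT_map_norm_square_le_progress:
  obtains C where "C > 0" "\<And>k. (norm (KKT_map f g A B c (iterate (Suc k))))\<^sup>2 \<le> C * progress k"
proof -
  obtain KS where KS: "KS > 0" "\<And>v. (norm (S v))\<^sup>2 \<le> KS * (v \<bullet> S v)"
    using psd_operator_norm_square_le[OF psd_S] by blast
  obtain KT where KT: "KT > 0" "\<And>v. (norm (T v))\<^sup>2 \<le> KT * (v \<bullet> T v)"
    using psd_operator_norm_square_le[OF psd_T] by blast
  obtain KA where KA: "KA > 0" "\<And>p. norm (A p) \<le> KA * norm p"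
    using linear_bounded_pos[OF lin_A] by blast
  define C1 where "C1 = 3 * (\<sigma> * (1 - \<rho>) * KA)\<^sup>2 + 1"
  define C2 where "C2 = 3 * (\<sigma> * (2 - \<rho>) * KA)\<^sup>2"
  define C where "C = C1 + C2 + 3 * KS + KT"
  have "C1 \<ge> 0" "C2 \<ge> 0"
    by (simp_all add: C1_def C2_def)
  then have C12: "C1 \<ge> 0" "C2 \<ge> 0" "C > 0"
    unfolding C_def using KS(1) KT(1) by linarith+
  have "(norm (KKT_map f g A B c (iterate (Suc k))))\<^sup>2 \<le> C * progress k" for k
  proof -
    define \<beta> e where "\<beta> = z_shift k" and "e = half_step_residual k + z_shift k"
    define s t where "s = (op_norm_wrt S (ys (Suc k) - ys k))\<^sup>2" and "t = (op_norm_wrt T (zs (Suc k) - zs k))\<^sup>2"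
    define \<xi> where "\<xi> = A (xs k - \<sigma> *\<^sub>R half_step_residual k) - S (ys (Suc k) - ys k)"
    define \<zeta> where "\<zeta> = B (xs (Suc k)) - T (zs (Suc k) - zs k)"
    define Ry where "Ry = ys (Suc k) - Prox f (ys (Suc k) + A (xs (Suc k)))"
    define Rz where "Rz = zs (Suc k) - Prox g (zs (Suc k) + B (xs (Suc k)))"
    have "norm Ry \<le> norm (\<xi> - A (xs (Suc k)))"
      unfolding Ry_def \<xi>_def by (rule norm_diff_Prox_le[OF f y_step_subgradient])
    also have "\<xi> - A (xs (Suc k)) = A (xs k - \<sigma> *\<^sub>R half_step_residual k - xs (Suc k)) - S (ys (Suc k) - ys k)"
      unfolding \<xi>_def by (simp add: linear_diff[OF lin_A])
    also have "xs k - \<sigma> *\<^sub>R half_step_residual k - xs (Suc k) = (\<sigma> * (2 - \<rho>)) *\<^sub>R \<beta> - (\<sigma> * (1 - \<rho>)) *\<^sub>R e"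
      unfolding multiplier_step \<beta>_def e_def
      by (simp add: algebra_simps) (metis scaleR_left_distrib mult_2_right)
    also have "norm (A ((\<sigma> * (2 - \<rho>)) *\<^sub>R \<beta> - (\<sigma> * (1 - \<rho>)) *\<^sub>R e) - S (ys (Suc k) - ys k))
        \<le> norm (A ((\<sigma> * (2 - \<rho>)) *\<^sub>R \<beta>)) + norm (A ((\<sigma> * (1 - \<rho>)) *\<^sub>R e)) + norm (S (ys (Suc k) - ys k))"
      unfolding linear_diff[OF lin_A] by (meson norm_triangle_ineq4 add_right_mono order_trans)
    finally have "(norm Ry)\<^sup>2 \<le> (norm (A ((\<sigma> * (2 - \<rho>)) *\<^sub>R \<beta>)) + norm (A ((\<sigma> * (1 - \<rho>)) *\<^sub>R e))
        + norm (S (ys (Suc k) - ys k)))\<^sup>2"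
      by (intro power_mono) auto
    also have "\<dots> \<le> 3 * (norm (A ((\<sigma> * (2 - \<rho>)) *\<^sub>R \<beta>)))\<^sup>2 + 3 * (norm (A ((\<sigma> * (1 - \<rho>)) *\<^sub>R e)))\<^sup>2
        + 3 * (norm (S (ys (Suc k) - ys k)))\<^sup>2"
    proof -
      have "(p + q + r)\<^sup>2 \<le> 3 * p\<^sup>2 + 3 * q\<^sup>2 + 3 * r\<^sup>2" for p q r :: real
      proof -
        have "0 \<le> (p - q)\<^sup>2 + (q - r)\<^sup>2 + (p - r)\<^sup>2"
          by simp
        also have "\<dots> = 3 * p\<^sup>2 + 3 * q\<^sup>2 + 3 * r\<^sup>2 - (p + q + r)\<^sup>2"
          by (simp add: power2_eq_square algebra_simps)
        finally show ?thesis
          by simp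
      qed
      then show ?thesis .
    qed
    also have "\<dots> \<le> C2 * (norm \<beta>)\<^sup>2 + (C1 - 1) * (norm e)\<^sup>2 + 3 * KS * s"
    proof -
      have "(norm (A (a *\<^sub>R p)))\<^sup>2 \<le> (a * KA)\<^sup>2 * (norm p)\<^sup>2" for a p
      proof -
        have "norm (A (a *\<^sub>R p)) \<le> \<bar>a\<bar> * (KA * norm p)"
          using KA(2)[of p] by (simp add: linear_scale[OF lin_A] mult_left_mono)
        then have "(norm (A (a *\<^sub>R p)))\<^sup>2 \<le> (\<bar>a\<bar> * (KA * norm p))\<^sup>2"
          by (intro power_mono) auto
        then show ?thesis
          by (simp add: power_mult_distrib mult_ac)
      qed
      from this[of "\<sigma> * (2 - \<rho>)" \<beta>] this[of "\<sigma> * (1 - \<rho>)" e] show ?thesis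
        using KS(2)[of "ys (Suc k) - ys k"]
        by (simp add: C1_def C2_def s_def op_norm_wrt_square[OF psd_S])
    qed
    finally have Ry: "(norm Ry)\<^sup>2 \<le> C2 * (norm \<beta>)\<^sup>2 + (C1 - 1) * (norm e)\<^sup>2 + 3 * KS * s" .
    have "norm Rz \<le> norm (\<zeta> - B (xs (Suc k)))"
      unfolding Rz_def \<zeta>_def by (rule norm_diff_Prox_le[OF g z_step_subgradient])
    then have "(norm Rz)\<^sup>2 \<le> (norm (T (zs (Suc k) - zs k)))\<^sup>2"
      by (intro power_mono) (auto simp: \<zeta>_def)
    also have "\<dots> \<le> KT * t"
      using KT(2) by (simp add: t_def op_norm_wrt_square[OF psd_T])
    finally have Rz: "(norm Rz)\<^sup>2 \<le> KT * t" .
    have "KKT_map f g A B c (iterate (Suc k)) = (Ry, Rz, e)"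
      by (simp add: KKT_map_def Ry_def Rz_def e_def primal_residual)
    then have "(norm (KKT_map f g A B c (iterate (Suc k))))\<^sup>2 = (norm Ry)\<^sup>2 + (norm Rz)\<^sup>2 + (norm e)\<^sup>2"
      by (simp add: norm_prod_def)
    also have "\<dots> \<le> C1 * (norm e)\<^sup>2 + C2 * (norm \<beta>)\<^sup>2 + 3 * KS * s + KT * t"
      using Ry Rz by (simp add: left_diff_distrib)
    also have "\<dots> \<le> C * (norm e)\<^sup>2 + C * (norm \<beta>)\<^sup>2 + C * s + C * t"
      using C12 KS(1) KT(1) by (intro add_mono mult_right_mono) (auto simp: C_def s_def t_def)
    also have "\<dots> = C * progress k"
      by (simp add: progress_def e_def \<beta>_def s_def t_def distrib_left)
    finally show ?thesis .
  qed
  with C12(3) show ?thesis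
    by (rule that)
qed

section \<open>Linear rate of the Lyapunov function\<close>

lemma inner_Mbar:
  "u \<bullet> Mbar u = \<rho> / (2 - \<rho>) * (u \<bullet> M_op A B S T Sf Sg \<rho> \<sigma> u)"
  by (simp add: Mbar_op_def)

lemma inner_Mbar_nonneg: "0 \<le> u \<bullet> Mbar u"
  unfolding inner_Mbar using \<rho>_pos \<rho>_less
  by (intro mult_nonneg_nonneg inner_M_op_nonneg lin_A lin_B psd_S psd_T psd_Sf psd_Sg \<sigma>_pos) auto

lemma linear_Mbar: "linear Mbar"
proof -
  have "linear (M_op A B S T Sf Sg \<rho> \<sigma>)"
    using lin_A lin_B psd_S psd_T psd_Sf psd_Sg by (intro linear_M_op) (auto simp: psd_operator_def)
  then show ?thesis
    unfolding Mbar_op_def by (rule linear_compose_scale_right)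
qed

text \<open>
  The one-step estimate is applied from iterate \<open>Suc k\<close> on, because it uses the optimality condition
  of the preceding \<open>z\<close>-step, which the starting point need not satisfy. The factor
  \<open>\<rho> / (2 - \<rho>)\<close> between the two metrics turns the weight of the \<open>T\<close>-terms into 1.
\<close>

lemma descent_to_KKT_point:
  obtains \<delta> where "\<delta> > 0" "\<And>k v. v \<in> \<Omega> \<Longrightarrow>
    (op_norm_wrt Mbar (iterate (Suc (Suc k)) - v))\<^sup>2 + (op_norm_wrt T (zs (Suc (Suc k)) - zs (Suc k)))\<^sup>2
      + \<delta> * progress (Suc k)
    \<le> (op_norm_wrt Mbar (iterate (Suc k) - v))\<^sup>2 + (op_norm_wrt T (zs (Suc k) - zs k))\<^sup>2"
proof -
  define \<mu> where "\<mu> = min ((2 - \<rho>) * \<sigma> / 2) (min ((2 - \<rho>)\<^sup>2 / \<rho> * \<sigma>) 1)"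
  have "\<mu> > 0"
    using \<rho>_pos \<rho>_less \<sigma>_pos by (auto simp: \<mu>_def)
  show ?thesis
  proof (rule that[of "\<rho> / (2 - \<rho>) * \<mu>"])
    show "\<rho> / (2 - \<rho>) * \<mu> > 0"
      using \<open>\<mu> > 0\<close> \<rho>_pos \<rho>_less by simp
    fix k v assume v: "v \<in> \<Omega>"
    obtain yv zv xv where v_eq: "v = (yv, zv, xv)"
      by (cases v) auto
    with v have KKT: "A xv \<in> subdifferential f yv" "B xv \<in> subdifferential g zv"
      "adjoint A yv + adjoint B zv = c"
      by (auto simp: KKT_points_def)
    define r \<beta> where "r = half_step_residual (Suc k)" and "\<beta> = z_shift (Suc k)"
    define y z x where "y = ys (Suc k) - yv" and "z = zs (Suc k) - zv" and "x = xs (Suc k) - xv"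
    define y' z' x' where "y' = ys (Suc (Suc k)) - yv" and "z' = zs (Suc (Suc k)) - zv"
      and "x' = xs (Suc (Suc k)) - xv"
    define w where "w = zs (Suc k) - zs k"
    have diffs: "y' - y = ys (Suc (Suc k)) - ys (Suc k)" "z' - z = zs (Suc (Suc k)) - zs (Suc k)"
      by (simp_all add: y'_def y_def z'_def z_def)
    have sub_z: "B (xs (Suc (Suc k))) - T (z' - z) \<in> subdifferential g (zs (Suc (Suc k)))"
      "B (xs (Suc k)) - T w \<in> subdifferential g (zs (Suc k))"
      using z_step_subgradient[of "Suc k"] z_step_subgradient[of k] by (simp_all add: diffs w_def)
    have sub_y: "A (xs (Suc k) - \<sigma> *\<^sub>R r) - S (y' - y) \<in> subdifferential f (ys (Suc (Suc k)))"
      using y_step_subgradient[of "Suc k"] by (simp add: diffs r_def)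
    have "r = adjoint A y' + adjoint B z"
      using KKT(3) by (simp add: r_def half_step_residual_def y'_def z_def
          linear_diff[OF adjoint_linear[OF lin_A]] linear_diff[OF adjoint_linear[OF lin_B]] algebra_simps)
    moreover have "\<beta> = adjoint B (z' - z)"
      by (simp add: \<beta>_def z_shift_def diffs)
    moreover have "x' = x - \<sigma> *\<^sub>R (\<rho> *\<^sub>R r + \<beta>)"
      unfolding x'_def x_def r_def \<beta>_def multiplier_step by simp
    moreover have "y' \<bullet> Sf y' \<le> (A (x - \<sigma> *\<^sub>R r) - S (y' - y)) \<bullet> y'"
    proof -
      have "(op_norm_wrt Sf y')\<^sup>2 \<le> (A (xs (Suc k) - \<sigma> *\<^sub>R r) - S (y' - y) - A xv) \<bullet> y'"
        using mono_f KKT(1) sub_y subdifferential_eff_dom[OF f KKT(1)] subdifferential_eff_dom[OF f sub_y]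
        unfolding monotone_modulus_def y'_def by blast
      moreover have "A (xs (Suc k) - \<sigma> *\<^sub>R r) - S (y' - y) - A xv = A (x - \<sigma> *\<^sub>R r) - S (y' - y)"
        by (simp add: x_def linear_diff[OF lin_A])
      ultimately show ?thesis
        by (simp add: op_norm_wrt_square[OF psd_Sf])
    qed
    moreover have "z' \<bullet> Sg z' \<le> (B x' - T (z' - z)) \<bullet> z'"
    proof -
      have "(op_norm_wrt Sg z')\<^sup>2 \<le> (B (xs (Suc (Suc k))) - T (z' - z) - B xv) \<bullet> z'"
        using mono_g KKT(2) sub_z(1) subdifferential_eff_dom[OF g KKT(2)] subdifferential_eff_dom[OF g sub_z(1)]
        unfolding monotone_modulus_def z'_def by blast
      moreover have "B (xs (Suc (Suc k))) - T (z' - z) - B xv = B x' - T (z' - z)"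
        by (simp add: x'_def linear_diff[OF lin_B])
      ultimately show ?thesis
        by (simp add: op_norm_wrt_square[OF psd_Sg])
    qed
    moreover have "0 \<le> ((B x' - T (z' - z)) - (B x - T w)) \<bullet> (z' - z)"
      using subdifferential_monotone[OF g sub_z]
      by (simp add: diffs x'_def x_def linear_diff[OF lin_B])
    ultimately have main: "(y', z', x') \<bullet> M_op A B S T Sf Sg \<rho> \<sigma> (y', z', x')
        + (2 - \<rho>) / \<rho> * ((z' - z) \<bullet> T (z' - z))
        + ((2 - \<rho>) * \<sigma> / 2 * (norm (r + \<beta>))\<^sup>2 + (2 - \<rho>)\<^sup>2 / \<rho> * \<sigma> * (norm \<beta>)\<^sup>2
          + (y' - y) \<bullet> S (y' - y) + (z' - z) \<bullet> T (z' - z))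
      \<le> (y, z, x) \<bullet> M_op A B S T Sf Sg \<rho> \<sigma> (y, z, x) + (2 - \<rho>) / \<rho> * (w \<bullet> T w)"
      by (rule inner_M_op_descent[OF lin_A lin_B \<rho>_pos \<rho>_less \<sigma>_pos psd_S psd_T psd_Sf psd_Sg])
    have "\<mu> * progress (Suc k) = \<mu> * (norm (r + \<beta>))\<^sup>2 + \<mu> * (norm \<beta>)\<^sup>2
        + \<mu> * ((y' - y) \<bullet> S (y' - y)) + \<mu> * ((z' - z) \<bullet> T (z' - z))"
      by (simp add: progress_def r_def \<beta>_def diffs op_norm_wrt_square[OF psd_S]
          op_norm_wrt_square[OF psd_T] distrib_left)
    also have "\<dots> \<le> (2 - \<rho>) * \<sigma> / 2 * (norm (r + \<beta>))\<^sup>2 + (2 - \<rho>)\<^sup>2 / \<rho> * \<sigma> * (norm \<beta>)\<^sup>2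
        + 1 * ((y' - y) \<bullet> S (y' - y)) + 1 * ((z' - z) \<bullet> T (z' - z))"
    proof -
      have "\<mu> \<le> (2 - \<rho>) * \<sigma> / 2" "\<mu> \<le> (2 - \<rho>)\<^sup>2 / \<rho> * \<sigma>" "\<mu> \<le> 1"
        unfolding \<mu>_def by linarith+
      then show ?thesis
        using psd_S psd_T by (intro add_mono mult_right_mono) (auto simp: psd_operator_def)
    qed
    finally have "(y', z', x') \<bullet> M_op A B S T Sf Sg \<rho> \<sigma> (y', z', x')
        + (2 - \<rho>) / \<rho> * ((z' - z) \<bullet> T (z' - z)) + \<mu> * progress (Suc k)
      \<le> (y, z, x) \<bullet> M_op A B S T Sf Sg \<rho> \<sigma> (y, z, x) + (2 - \<rho>) / \<rho> * (w \<bullet> T w)"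
      using main by linarith
    then have "\<rho> / (2 - \<rho>) * ((y', z', x') \<bullet> M_op A B S T Sf Sg \<rho> \<sigma> (y', z', x')
        + (2 - \<rho>) / \<rho> * ((z' - z) \<bullet> T (z' - z)) + \<mu> * progress (Suc k))
      \<le> \<rho> / (2 - \<rho>) * ((y, z, x) \<bullet> M_op A B S T Sf Sg \<rho> \<sigma> (y, z, x) + (2 - \<rho>) / \<rho> * (w \<bullet> T w))"
      using \<rho>_pos \<rho>_less by (intro mult_left_mono) auto
    moreover have "\<rho> / (2 - \<rho>) * ((2 - \<rho>) / \<rho> * s) = s" for s
      using \<rho>_pos \<rho>_less by simp
    ultimately have "(y', z', x') \<bullet> Mbar (y', z', x') + (z' - z) \<bullet> T (z' - z)
        + \<rho> / (2 - \<rho>) * \<mu> * progress (Suc k) \<le> (y, z, x) \<bullet> Mbar (y, z, x) + w \<bullet> T w"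
      unfolding inner_Mbar distrib_left mult.assoc by simp
    moreover have "iterate (Suc (Suc k)) - v = (y', z', x')" "iterate (Suc k) - v = (y, z, x)"
      by (simp_all add: v_eq y'_def y_def z'_def z_def x'_def x_def)
    ultimately show "(op_norm_wrt Mbar (iterate (Suc (Suc k)) - v))\<^sup>2
        + (op_norm_wrt T (zs (Suc (Suc k)) - zs (Suc k)))\<^sup>2 + \<rho> / (2 - \<rho>) * \<mu> * progress (Suc k)
      \<le> (op_norm_wrt Mbar (iterate (Suc k) - v))\<^sup>2 + (op_norm_wrt T (zs (Suc k) - zs k))\<^sup>2"
      by (simp add: op_norm_wrt_def[of Mbar] inner_Mbar_nonneg op_norm_wrt_square[OF psd_T] diffs w_def)
  qed
qed

text \<open>
  The error bound makes the new Lyapunov value at most a multiple \<open>L\<close> of the progress of the step,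
  while the decrease is at least \<open>\<delta>\<close> times that progress; hence each value is at most
  \<open>1 / (1 + \<delta> / L)\<close> times the one before.
\<close>

lemma lyapunov_linear_rate:
  assumes ne: "\<Omega> \<noteq> {}"
    and \<kappa>: "\<And>k. infdist (iterate k) \<Omega> \<le> \<kappa> * norm (KKT_map f g A B c (iterate k))"
  shows "\<exists>q<1. \<forall>k\<ge>1. lyapunov (k + 1) \<le> q * lyapunov k"
proof -
  obtain \<delta> where \<delta>: "\<delta> > 0" "\<And>k v. v \<in> \<Omega> \<Longrightarrow>
    (op_norm_wrt Mbar (iterate (Suc (Suc k)) - v))\<^sup>2 + (op_norm_wrt T (zs (Suc (Suc k)) - zs (Suc k)))\<^sup>2
      + \<delta> * progress (Suc k)
    \<le> (op_norm_wrt Mbar (iterate (Suc k) - v))\<^sup>2 + (op_norm_wrt T (zs (Suc k) - zs k))\<^sup>2"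
    using descent_to_KKT_point by blast
  obtain C where C: "C > 0"
    "\<And>k. (norm (KKT_map f g A B c (iterate (Suc k))))\<^sup>2 \<le> C * progress k"
    using KKT_map_norm_square_le_progress by blast
  obtain K where K: "K > 0" "\<And>u C. C \<noteq> {} \<Longrightarrow> (op_dist_wrt Mbar u C)\<^sup>2 \<le> K * (infdist u C)\<^sup>2"
    using op_dist_wrt_square_le_infdist[OF inner_Mbar_nonneg linear_Mbar] by blast
  define L where "L = K * (\<kappa>\<^sup>2 * C) + 1"
  have "L > 0"
    unfolding L_def using K(1) C(1) by (intro add_nonneg_pos mult_nonneg_nonneg) auto
  have bound: "lyapunov (Suc (Suc k)) \<le> L * progress (Suc k)" for k
  proof -
    have "(op_dist_wrt Mbar (iterate (Suc (Suc k))) \<Omega>)\<^sup>2 \<le> K * (infdist (iterate (Suc (Suc k))) \<Omega>)\<^sup>2"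
      by (rule K(2)[OF ne])
    also have "\<dots> \<le> K * (\<kappa> * norm (KKT_map f g A B c (iterate (Suc (Suc k)))))\<^sup>2"
      using K(1) \<kappa> by (intro mult_left_mono power_mono) (auto simp: infdist_nonneg)
    also have "\<dots> \<le> K * (\<kappa>\<^sup>2 * (C * progress (Suc k)))"
      unfolding power_mult_distrib using K(1) C(2) by (intro mult_left_mono) auto
    finally have "(op_dist_wrt Mbar (iterate (Suc (Suc k))) \<Omega>)\<^sup>2 \<le> K * (\<kappa>\<^sup>2 * C) * progress (Suc k)"
      by (simp add: mult_ac)
    moreover have "(op_norm_wrt T (zs (Suc (Suc k)) - zs (Suc k)))\<^sup>2 \<le> progress (Suc k)"
      by (simp add: progress_def)
    ultimately show ?thesis
      by (simp add: lyapunov_def L_def distrib_right)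
  qed
  have descent: "lyapunov (Suc (Suc k)) + \<delta> * progress (Suc k) \<le> lyapunov (Suc k)" for k
  proof -
    have "(op_dist_wrt Mbar (iterate (Suc (Suc k))) \<Omega>)\<^sup>2 + (op_norm_wrt T (zs (Suc (Suc k)) - zs (Suc k)))\<^sup>2
      + \<delta> * progress (Suc k) - (op_norm_wrt T (zs (Suc k) - zs k))\<^sup>2
      \<le> (op_dist_wrt Mbar (iterate (Suc k)) \<Omega>)\<^sup>2"
    proof (rule op_dist_wrt_square_greatest[OF inner_Mbar_nonneg ne])
      fix v assume v: "v \<in> \<Omega>"
      have "(op_dist_wrt Mbar (iterate (Suc (Suc k))) \<Omega>)\<^sup>2 \<le> (op_norm_wrt Mbar (iterate (Suc (Suc k)) - v))\<^sup>2"
        using op_dist_wrt_nonneg_le[OF inner_Mbar_nonneg v] by (intro power_mono)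
      then show "(op_dist_wrt Mbar (iterate (Suc (Suc k))) \<Omega>)\<^sup>2 + (op_norm_wrt T (zs (Suc (Suc k)) - zs (Suc k)))\<^sup>2
          + \<delta> * progress (Suc k) - (op_norm_wrt T (zs (Suc k) - zs k))\<^sup>2
        \<le> (op_norm_wrt Mbar (iterate (Suc k) - v))\<^sup>2"
        using \<delta>(2)[OF v, of k] by linarith
    qed
    then show ?thesis
      by (simp add: lyapunov_def)
  qed
  show ?thesis
  proof (intro exI[of _ "1 / (1 + \<delta> / L)"] conjI allI impI)
    have "\<delta> / L > 0"
      using \<delta>(1) \<open>L > 0\<close> by simp
    then show "1 / (1 + \<delta> / L) < 1"
      by (subst divide_less_eq_1_pos) linarith+
    fix k :: nat assume "k \<ge> 1"
    then obtain j where j: "k = Suc j"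
      by (cases k) auto
    have "\<delta> / L * lyapunov (Suc (Suc j)) \<le> \<delta> / L * (L * progress (Suc j))"
      using bound[of j] \<delta>(1) \<open>L > 0\<close> by (intro mult_left_mono) auto
    also have "\<dots> = \<delta> * progress (Suc j)"
      using \<open>L > 0\<close> by simp
    finally have "(1 + \<delta> / L) * lyapunov (Suc (Suc j)) \<le> lyapunov (Suc j)"
      using descent[of j] by (simp add: distrib_right)
    moreover have "1 + \<delta> / L > 0"
      using \<delta>(1) \<open>L > 0\<close> by (simp add: add_pos_pos)
    ultimately show "lyapunov (k + 1) \<le> 1 / (1 + \<delta> / L) * lyapunov k"
      by (simp add: j pos_le_divide_eq mult.commute)
  qed
qed

end

theorem corollary1:
  fixes A :: "'x::euclidean_space \<Rightarrow> 'y::euclidean_space"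
    and B :: "'x \<Rightarrow> 'z::euclidean_space"
    and c :: 'x
    and m n :: nat
    and Y :: "nat \<Rightarrow> 'y set" and Z :: "nat \<Rightarrow> 'z set"
    and f f1 :: "'y \<Rightarrow> ereal" and f2 :: "'y \<Rightarrow> real"
    and g g1 :: "'z \<Rightarrow> ereal" and g2 :: "'z \<Rightarrow> real"
    and Sf S :: "'y \<Rightarrow> 'y" and Sg T :: "'z \<Rightarrow> 'z"
    and \<rho> \<sigma> :: real
    and ys :: "nat \<Rightarrow> 'y" and zs :: "nat \<Rightarrow> 'z" and xs :: "nat \<Rightarrow> 'x"
    and ubar :: "'y \<times> 'z \<times> 'x"
  assumes "linear A" and "linear B"
    and "orthogonal_blocks m Y" and "orthogonal_blocks n Z"
    and "closed_proper_convex_on UNIV f" and "closed_proper_convex_on UNIV g"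
    and "closed_proper_convex_on (Y 1) f1" and "closed_proper_convex_on (Z 1) g1"
    and "convex_quadratic f2" and "convex_quadratic g2"
    and "composite_form m Y f f1 f2" and "composite_form n Z g g1 g2"
    and "psd_operator Sf" and "psd_operator Sg"
    and "monotone_modulus f Sf" and "monotone_modulus g Sg"
    and "psd_operator S" and "psd_operator T"
    and "0 < \<rho>" and "\<rho> < 2" and "0 < \<sigma>"
    and "KKT_points f g A B c \<noteq> {}"
    and "pd_operator (\<lambda>y. Sf y + S y + \<sigma> *\<^sub>R A (adjoint A y))"
    and "pd_operator (\<lambda>z. Sg z + T z + \<sigma> *\<^sub>R B (adjoint B z))"
    and "sPGADMM f g A B c S T \<rho> \<sigma> ys zs xs"
    and "(\<lambda>k. (ys k, zs k, xs k)) \<longlonglongrightarrow> ubar" and "ubar \<in> KKT_points f g A B c"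
    and "piecewise_polyhedral (KKT_map f g A B c)"
  shows "\<exists>\<kappa>>0.
    (\<forall>k. infdist (ys k, zs k, xs k) (KKT_points f g A B c)
           \<le> \<kappa> * norm (KKT_map f g A B c (ys k, zs k, xs k))) \<and>
    (\<forall>k\<ge>1.
       (op_dist_wrt (Mbar_op A B S T Sf Sg \<rho> \<sigma>) (ys (k + 1), zs (k + 1), xs (k + 1))
          (KKT_points f g A B c))\<^sup>2
         + (op_norm_wrt T (zs (k + 1) - zs k))\<^sup>2
       \<le> theta_hat A B S T Sf Sg \<rho> \<sigma> \<kappa> *
          ((op_dist_wrt (Mbar_op A B S T Sf Sg \<rho> \<sigma>) (ys k, zs k, xs k)
              (KKT_points f g A B c))\<^sup>2
            + (op_norm_wrt T (zs k - zs (k - 1)))\<^sup>2))"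
proof -
  let ?\<Omega> = "KKT_points f g A B c" and ?u = "\<lambda>k. (ys k, zs k, xs k)"
  interpret sPGADMM_run A B c f g Sf S Sg T \<rho> \<sigma> ys zs xs
    using assms by (intro sPGADMM_run.intro)
  have zeros: "{u. KKT_map f g A B c u = 0} = ?\<Omega>"
    using assms by (intro KKT_map_zeros)
  have "bounded (range ?u)"
    using assms by (intro convergent_imp_bounded)
  then obtain \<kappa>0 where \<kappa>0: "\<kappa>0 > 0"
    "\<And>u. u \<in> range ?u \<Longrightarrow> infdist u ?\<Omega> \<le> \<kappa>0 * norm (KKT_map f g A B c u)"
  proof (rule piecewise_polyhedral_error_bound[OF \<open>piecewise_polyhedral (KKT_map f g A B c)\<close>, rotated])
    show "KKT_map f g A B c ubar = 0"
      using \<open>ubar \<in> ?\<Omega>\<close> zeros by blast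
  qed (use zeros in auto)
  have "\<exists>q<1. \<forall>k\<ge>1. lyapunov (k + 1) \<le> q * lyapunov k"
  proof (rule lyapunov_linear_rate[OF \<open>?\<Omega> \<noteq> {}\<close>])
    show "infdist (?u k) ?\<Omega> \<le> \<kappa>0 * norm (KKT_map f g A B c (?u k))" for k
      by (rule \<kappa>0(2)) (rule rangeI)
  qed
  then obtain q where q: "q < 1" "\<forall>k\<ge>1. lyapunov (k + 1) \<le> q * lyapunov k"
    by blast
  \<comment> \<open>Both required inequalities persist when \<open>\<kappa>\<close> grows, since the contraction factor tends to 1.\<close>
  have "\<forall>\<^sub>F \<kappa> in at_top. q < theta_hat A B S T Sf Sg \<rho> \<sigma> \<kappa>"
    using \<open>0 < \<rho>\<close> by (intro order_tendstoD(1)[OF theta_hat_tendsto_1 q(1)]) simp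
  moreover have "\<forall>\<^sub>F \<kappa> in at_top. \<kappa>0 \<le> \<kappa>"
    by (rule eventually_ge_at_top)
  ultimately have "\<forall>\<^sub>F \<kappa> in at_top. q < theta_hat A B S T Sf Sg \<rho> \<sigma> \<kappa> \<and> \<kappa>0 \<le> \<kappa>"
    by (rule eventually_conj)
  then obtain \<kappa> where \<kappa>: "q < theta_hat A B S T Sf Sg \<rho> \<sigma> \<kappa>" "\<kappa>0 \<le> \<kappa>"
    using eventually_happens'[OF trivial_limit_at_top_linorder] by blast
  show ?thesis
  proof (intro exI[of _ \<kappa>] conjI allI impI)
    show "\<kappa> > 0"
      using \<kappa>0(1) \<kappa>(2) by linarith
    show "infdist (?u k) ?\<Omega> \<le> \<kappa> * norm (KKT_map f g A B c (?u k))" for k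
      using \<kappa>0(2)[of "?u k"] mult_right_mono[OF \<kappa>(2) norm_ge_zero[of "KKT_map f g A B c (?u k)"]]
      by fastforce
    fix k :: nat assume k: "1 \<le> k"
    have "lyapunov (k + 1) \<le> q * lyapunov k"
      using q(2) k by blast
    also have "\<dots> \<le> theta_hat A B S T Sf Sg \<rho> \<sigma> \<kappa> * lyapunov k"
      using \<kappa>(1) by (intro mult_right_mono) (auto simp: lyapunov_def)
    finally show "(op_dist_wrt Mbar (?u (k + 1)) ?\<Omega>)\<^sup>2 + (op_norm_wrt T (zs (k + 1) - zs k))\<^sup>2
      \<le> theta_hat A B S T Sf Sg \<rho> \<sigma> \<kappa> *
        ((op_dist_wrt Mbar (?u k) ?\<Omega>)\<^sup>2 + (op_norm_wrt T (zs k - zs (k - 1)))\<^sup>2)"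
      by (simp add: lyapunov_def)
  qed
qed

end
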